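(* Let $H$ be a real separable Hilbert space and let $\gamma$ be a centered non-degenerate Gaussian measure on $(H,\mathcal{B}(H))$ with covariance operator $Q$ (a self-adjoint, non-negative, trace class operator with $\ker Q=\{0\}$). Let $\nabla_{H_{Q^{1/2}}}$ (Malliavin derivative in the sense of Gross) and $M$ (Malliavin derivative in the sense of Cannarsa--Da Prato) be the closed operators in $L^2$ described in the context, with domains $W^{1,2}_{H_{Q^{1/2}}}(H,\gamma)$ and $W^{1,2}_{Q^{1/2}}(H,\gamma)$, respectively. Then the two operators have the same domain, $$W_{Q^{1/2}}^{1,2}(H,\gamma)=W_{H_{Q^{1/2}}}^{1,2}(H,\gamma),$$ and they are linked by the relation $$\nabla_{H_{Q^{1/2}}}=Q^{1/2}M.$$ In particular, if $H$ is infinite dimensional, the two operators (regarded as $H$-valued operators through the inclusion $H_{Q^{1/2}}\subseteq H$) are different.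
   Context: $H_{Q^{1/2}}:=Q^{1/2}(H)$ is the Cameron--Martin space of $\gamma$, a Hilbert space with inner product $\langle h,k\rangle_{H_{Q^{1/2}}}:=\langle Q^{-1/2}h,Q^{-1/2}k\rangle_H$. $C^1_b(H)$ is the space of bounded, continuously Fréchet differentiable functions $\varphi:H\to\mathbb{R}$ with bounded derivative. Gross gradient: for $\varphi\in C_b^1(H)$, $\nabla_{H_{Q^{1/2}}}\varphi(x)\in H_{Q^{1/2}}$ is the unique element with $\lim_{\|h\|_{H_{Q^{1/2}}}\to0}\frac{|\varphi(x+h)-\varphi(x)-\langle\nabla_{H_{Q^{1/2}}}\varphi(x),h\rangle_{H_{Q^{1/2}}}|}{\|h\|_{H_{Q^{1/2}}}}=0$. Cannarsa--Da Prato gradient: for $\varphi\in C_b^1(H)$, $\nabla_{Q^{1/2}}\varphi(x)\in H$ is the unique element with $\lim_{s\to0}\left|\frac{\varphi(x+sQ^{1/2}v)-\varphi(x)}{s}-\langle\nabla_{Q^{1/2}}\varphi(x),v\rangle_H\right|=0$ for all $v\in H$. It is known that $\nabla_{H_{Q^{1/2}}}:C_b^1(H)\subseteq L^2(H,\gamma)\to L^2(H,\gamma;H_{Q^{1/2}})$ and $\nabla_{Q^{1/2}}:C_b^1(H)\subseteq L^2(H,\gamma)\to L^2(H,\gamma;H)$ are closable. The closure of the first is still denoted by $\nabla_{H_{Q^{1/2}}}$ and its domain is $W^{1,2}_{H_{Q^{1/2}}}(H,\gamma)$, with norm given by $\|f\|^2=\|f\|^2_{L^2(H,\gamma)}+\|\nabla_{H_{Q^{1/2}}}f\|^2_{L^2(H,\gamma;H_{Q^{1/2}})}$.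 The closure of the second is denoted by $M$ and its domain is $W^{1,2}_{Q^{1/2}}(H,\gamma)$, with norm given by $\|f\|^2=\|f\|^2_{L^2(H,\gamma)}+\|Mf\|^2_{L^2(H,\gamma;H)}$. *)

theory Defs
  imports "HOL-Probability.Probability"
begin

section \<open>Operators on a Hilbert space\<close>

text \<open>A real separable Hilbert space is a type of sort \<open>{real_inner, polish_space}\<close>:
  for metric spaces, separability and second countability coincide.\<close>

definition self_adjoint :: "('a::real_inner \<Rightarrow> 'a) \<Rightarrow> bool" where
  "self_adjoint T \<longleftrightarrow> (\<forall>x y. inner (T x) y = inner x (T y))"

definition nonneg_op :: "('a::real_inner \<Rightarrow> 'a) \<Rightarrow> bool" where
  "nonneg_op T \<longleftrightarrow> (\<forall>x. 0 \<le> inner (T x) x)"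

definition op_sqrt :: "('a::real_inner \<Rightarrow> 'a) \<Rightarrow> 'a \<Rightarrow> 'a" where
  "op_sqrt T = (THE S. bounded_linear S \<and> self_adjoint S \<and> nonneg_op S \<and> S \<circ> S = T)"

definition op_abs :: "('a::real_inner \<Rightarrow> 'a) \<Rightarrow> 'a \<Rightarrow> 'a" where
  "op_abs T = op_sqrt (adjoint T \<circ> T)"

definition orthonormal_basis :: "'a::real_inner set \<Rightarrow> bool" where
  "orthonormal_basis E \<longleftrightarrow>
     pairwise orthogonal E \<and> (\<forall>e\<in>E. norm e = 1) \<and> closure (span E) = UNIV"

text \<open>Finiteness of the trace of \<open>|T|\<close> does not depend on the choice of the basis.\<close>

definition trace_class :: "('a::real_inner \<Rightarrow> 'a) \<Rightarrow> bool" where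
  "trace_class T \<longleftrightarrow> bounded_linear T \<and>
     (\<exists>E. orthonormal_basis E \<and> (\<lambda>e. inner (op_abs T e) e) summable_on E)"

section \<open>Gaussian measures\<close>

text \<open>Normal laws on the line; Dirac measures are included as the case of variance zero.\<close>

definition real_gaussian :: "real measure \<Rightarrow> bool" where
  "real_gaussian \<mu> \<longleftrightarrow>
     (\<exists>m. \<mu> = return borel m) \<or>
     (\<exists>m \<sigma>. 0 < \<sigma> \<and> \<mu> = density lborel (\<lambda>x. ennreal (normal_density m \<sigma> x)))"

definition gaussian_measure :: "'a::{real_inner, polish_space} measure \<Rightarrow> bool" where
  "gaussian_measure \<gamma> \<longleftrightarrow> prob_space \<gamma> \<and> sets \<gamma> = sets borel \<and>
     (\<forall>h. real_gaussian (distr \<gamma> borel (\<lambda>x. inner x h)))"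

definition centered :: "'a::{real_inner, polish_space} measure \<Rightarrow> bool" where
  "centered \<gamma> \<longleftrightarrow> (\<forall>h. (\<integral>x. inner x h \<partial>\<gamma>) = 0)"

text \<open>The covariance form of a centered measure: no mean is subtracted.\<close>

definition has_covariance ::
    "'a::{real_inner, polish_space} measure \<Rightarrow> ('a \<Rightarrow> 'a) \<Rightarrow> bool" where
  "has_covariance \<gamma> Q \<longleftrightarrow> (\<forall>h k. inner (Q h) k = (\<integral>x. inner x h * inner x k \<partial>\<gamma>))"

section \<open>The Cameron--Martin space\<close>

definition cm_space :: "('a::real_inner \<Rightarrow> 'a) \<Rightarrow> 'a set" where
  "cm_space Q = range (op_sqrt Q)"

definition cm_inner :: "('a::real_inner \<Rightarrow> 'a) \<Rightarrow> 'a \<Rightarrow> 'a \<Rightarrow> real" where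
  "cm_inner Q h k = inner (inv (op_sqrt Q) h) (inv (op_sqrt Q) k)"

definition cm_norm :: "('a::real_inner \<Rightarrow> 'a) \<Rightarrow> 'a \<Rightarrow> real" where
  "cm_norm Q h = sqrt (cm_inner Q h h)"

definition cm_topology :: "('a::real_inner \<Rightarrow> 'a) \<Rightarrow> 'a topology" where
  "cm_topology Q = Metric_space.mtopology (cm_space Q) (\<lambda>h k. cm_norm Q (h - k))"

definition cm_borel :: "('a::real_inner \<Rightarrow> 'a) \<Rightarrow> 'a measure" where
  "cm_borel Q = sigma (cm_space Q) {U. openin (cm_topology Q) U}"

section \<open>Gradients of smooth functions\<close>

definition Cb1 :: "('a::real_normed_vector \<Rightarrow> real) set" where
  "Cb1 = {\<phi>. bounded (range \<phi>) \<and>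
     (\<exists>D :: 'a \<Rightarrow> 'a \<Rightarrow>\<^sub>L real.
        (\<forall>x. (\<phi> has_derivative blinfun_apply (D x)) (at x)) \<and>
        continuous_on UNIV D \<and> bounded (range D))}"

definition is_gross_gradient ::
    "('a::real_inner \<Rightarrow> 'a) \<Rightarrow> ('a \<Rightarrow> real) \<Rightarrow> 'a \<Rightarrow> 'a \<Rightarrow> bool" where
  "is_gross_gradient Q \<phi> x g \<longleftrightarrow> g \<in> cm_space Q \<and>
     (\<forall>\<epsilon>>0. \<exists>\<delta>>0. \<forall>h\<in>cm_space Q. 0 < cm_norm Q h \<and> cm_norm Q h < \<delta> \<longrightarrow>
        \<bar>\<phi> (x + h) - \<phi> x - cm_inner Q g h\<bar> / cm_norm Q h < \<epsilon>)"

definition gross_gradient ::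
    "('a::real_inner \<Rightarrow> 'a) \<Rightarrow> ('a \<Rightarrow> real) \<Rightarrow> 'a \<Rightarrow> 'a" where
  "gross_gradient Q \<phi> x = (THE g. is_gross_gradient Q \<phi> x g)"

definition is_cdp_gradient ::
    "('a::real_inner \<Rightarrow> 'a) \<Rightarrow> ('a \<Rightarrow> real) \<Rightarrow> 'a \<Rightarrow> 'a \<Rightarrow> bool" where
  "is_cdp_gradient Q \<phi> x g \<longleftrightarrow>
     (\<forall>v. ((\<lambda>s. \<bar>(\<phi> (x + s *\<^sub>R op_sqrt Q v) - \<phi> x) / s - inner g v\<bar>) \<longlongrightarrow> 0) (at 0))"

definition cdp_gradient ::
    "('a::real_inner \<Rightarrow> 'a) \<Rightarrow> ('a \<Rightarrow> real) \<Rightarrow> 'a \<Rightarrow> 'a" where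
  "cdp_gradient Q \<phi> x = (THE g. is_cdp_gradient Q \<phi> x g)"

section \<open>Malliavin derivatives as closed operators\<close>

text \<open>Elements of the \<open>L\<^sup>2\<close> spaces are represented by functions, identified when they agree
  almost everywhere.\<close>

definition L2_fun ::
    "'a measure \<Rightarrow> ('a \<Rightarrow> 'b::{real_normed_vector, second_countable_topology}) set" where
  "L2_fun \<gamma> = {f \<in> borel_measurable \<gamma>. integrable \<gamma> (\<lambda>x. (norm (f x))\<^sup>2)}"

definition L2_cm ::
    "'a::{real_inner, polish_space} measure \<Rightarrow> ('a \<Rightarrow> 'a) \<Rightarrow> ('a \<Rightarrow> 'a) set" where
  "L2_cm \<gamma> Q = {G \<in> measurable \<gamma> (cm_borel Q). integrable \<gamma> (\<lambda>x. (cm_norm Q (G x))\<^sup>2)}"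

text \<open>The graphs of the closures: limits in the product of the \<open>L\<^sup>2\<close> spaces of sequences in the
  graph of the gradient on \<open>Cb1\<close>.\<close>

definition gross_graph ::
    "'a::{real_inner, polish_space} measure \<Rightarrow> ('a \<Rightarrow> 'a) \<Rightarrow> (('a \<Rightarrow> real) \<times> ('a \<Rightarrow> 'a)) set" where
  "gross_graph \<gamma> Q = {(f, G). f \<in> L2_fun \<gamma> \<and> G \<in> L2_cm \<gamma> Q \<and>
     (\<exists>\<phi>. (\<forall>n. \<phi> n \<in> Cb1) \<and>
        (\<lambda>n. \<integral>\<^sup>+x. ennreal ((\<phi> n x - f x)\<^sup>2) \<partial>\<gamma>) \<longlonglongrightarrow> 0 \<and>
        (\<lambda>n. \<integral>\<^sup>+x. ennreal ((cm_norm Q (gross_gradient Q (\<phi> n) x - G x))\<^sup>2) \<partial>\<gamma>) \<longlonglongrightarrow> 0)}"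

definition cdp_graph ::
    "'a::{real_inner, polish_space} measure \<Rightarrow> ('a \<Rightarrow> 'a) \<Rightarrow> (('a \<Rightarrow> real) \<times> ('a \<Rightarrow> 'a)) set" where
  "cdp_graph \<gamma> Q = {(f, G). f \<in> L2_fun \<gamma> \<and> G \<in> L2_fun \<gamma> \<and>
     (\<exists>\<phi>. (\<forall>n. \<phi> n \<in> Cb1) \<and>
        (\<lambda>n. \<integral>\<^sup>+x. ennreal ((\<phi> n x - f x)\<^sup>2) \<partial>\<gamma>) \<longlonglongrightarrow> 0 \<and>
        (\<lambda>n. \<integral>\<^sup>+x. ennreal ((norm (cdp_gradient Q (\<phi> n) x - G x))\<^sup>2) \<partial>\<gamma>) \<longlonglongrightarrow> 0)}"

definition W_gross ::
    "'a::{real_inner, polish_space} measure \<Rightarrow> ('a \<Rightarrow> 'a) \<Rightarrow> ('a \<Rightarrow> real) set" where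
  "W_gross \<gamma> Q = Domain (gross_graph \<gamma> Q)"

definition W_cdp ::
    "'a::{real_inner, polish_space} measure \<Rightarrow> ('a \<Rightarrow> 'a) \<Rightarrow> ('a \<Rightarrow> real) set" where
  "W_cdp \<gamma> Q = Domain (cdp_graph \<gamma> Q)"

text \<open>By closability the graphs determine the derivative up to null sets; the choice operator
  only picks a representative.\<close>

definition gross_derivative ::
    "'a::{real_inner, polish_space} measure \<Rightarrow> ('a \<Rightarrow> 'a) \<Rightarrow> ('a \<Rightarrow> real) \<Rightarrow> 'a \<Rightarrow> 'a" where
  "gross_derivative \<gamma> Q f = (SOME G. (f, G) \<in> gross_graph \<gamma> Q)"

definition cdp_derivative ::
    "'a::{real_inner, polish_space} measure \<Rightarrow> ('a \<Rightarrow> 'a) \<Rightarrow> ('a \<Rightarrow> real) \<Rightarrow> 'a \<Rightarrow> 'a" where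
  "cdp_derivative \<gamma> Q f = (SOME G. (f, G) \<in> cdp_graph \<gamma> Q)"

end

theory Submission
  imports Defs
begin

text \<open>
  Write \<open>R\<close> for the square root of \<open>Q\<close>; it is injective because \<open>Q\<close> is. If \<open>\<phi>\<close> is smooth with
  Hilbert-space gradient \<open>g(x)\<close>, then its derivative in a direction \<open>R v\<close> is
  \<open>\<langle>g(x), R v\<rangle> = \<langle>R g(x), v\<rangle>\<close>. So the Cannarsa--Da Prato gradient is \<open>R g(x)\<close>
  (\<open>cdp_gradient_eq\<close>). The Cameron--Martin product satisfies \<open>\<langle>R u, R v\<rangle> = \<langle>u, v\<rangle>\<close>, so the Gross
  gradient is \<open>R (R g(x))\<close> (\<open>gross_gradient_eq\<close>): one gradient is the image of the other under \<open>R\<close>.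
  Since \<open>R\<close> is an isometry of \<open>H\<close> onto the Cameron--Martin space, it carries the graph of one closure
  exactly onto the graph of the other (\<open>gross_graph_iff\<close>). This gives the equality of the domains.

  The identity between the derivatives also needs that each closure is single valued up to null sets
  (\<open>cdp_graph_unique\<close>), because the derivatives are arbitrarily chosen elements of the graphs. The reason is
  Gaussian integration by parts: \<open>\<integral>\<langle>\<nabla>\<phi>, Q h\<rangle> d\<gamma> = \<integral>\<phi>(x)\<langle>x, h\<rangle> d\<gamma>\<close> (\<open>gaussian_ibp\<close>). Applied
  to products of \<open>\<phi>\<close> with trigonometric functions, and passed to the \<open>L\<^sup>2\<close> limit, it expresses
  \<open>\<integral>\<langle>G(x), R h\<rangle> cos(\<langle>x, k\<rangle> + c) d\<gamma>\<close> by \<open>f\<close> alone whenever \<open>(f, G)\<close> is in the closed graph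
  (\<open>cdp_graph_ibp\<close>). Such integrals determine \<open>\<langle>G(x), R h\<rangle>\<close> almost everywhere, because a finite Borel measure
  on \<open>H\<close> is determined by its characteristic function (\<open>measure_eqI_cos\<close>). Integration by parts itself reduces
  to dimension one: replacing the component \<open>\<langle>x, h\<rangle>\<close> of a Gaussian vector by an independent standard normal
  variable does not change its law, as a comparison of characteristic functions shows (\<open>distr_resample\<close>).

  Finally, \<open>sin\<langle>x, k\<rangle>\<close> has the derivatives \<open>cos\<langle>x, k\<rangle> Q k\<close> and \<open>cos\<langle>x, k\<rangle> R k\<close>. If these agreed for all \<open>k\<close>
  then \<open>R\<^sup>2 = R\<close>, hence \<open>Q = id\<close>, which is trace class only in finite dimension.
\<close>

section \<open>Square roots of nonnegative operators\<close>

text \<open>For \<open>0 \<le> B \<le> 1\<close> the equation \<open>Y = (B + Y\<^sup>2) / 2\<close> says that \<open>1 - Y\<close> is a square root of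
  \<open>1 - B\<close>; the operator is obtained by fixed-point iteration from zero.\<close>

primrec sqrt_iter :: "('a::real_vector \<Rightarrow> 'a) \<Rightarrow> nat \<Rightarrow> 'a \<Rightarrow> 'a" where
  "sqrt_iter B 0 x = 0"
| "sqrt_iter B (Suc n) x = (1/2) *\<^sub>R (B x + sqrt_iter B n (sqrt_iter B n x))"

text \<open>The same iteration for \<open>B = 1\<close> on the real line. Since the iterates are polynomials
  in \<open>B\<close> with nonnegative coefficients, it dominates the operator iteration for every contraction \<open>B\<close>,
  and its convergence yields that of the operators.\<close>

primrec sqrt_majorant :: "nat \<Rightarrow> real" where
  "sqrt_majorant 0 = 0"
| "sqrt_majorant (Suc n) = (1 + (sqrt_majorant n)\<^sup>2) / 2"

lemma sqrt_majorant_bounds: "0 \<le> sqrt_majorant n \<and> sqrt_majorant n \<le> 1"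
  by (induction n) (auto simp: power_le_one)

lemma sqrt_majorant_convergent: "convergent sqrt_majorant"
proof -
  have "sqrt_majorant n \<le> sqrt_majorant (Suc n)" for n
    using zero_le_power2[of "1 - sqrt_majorant n"]
    by (simp add: power2_eq_square field_simps)
  then have "incseq sqrt_majorant" by (simp add: incseq_Suc_iff)
  moreover have "Bseq sqrt_majorant"
    by (rule BseqI'[of _ 1]) (use sqrt_majorant_bounds in auto)
  ultimately show ?thesis by (simp add: Bseq_mono_convergent incseq_def)
qed

lemma linear_sqrt_iter: "linear B \<Longrightarrow> linear (sqrt_iter B n)"
proof (induction n)
  case 0 show ?case by (rule linearI) auto
next
  case (Suc n)
  interpret B: linear B by fact
  interpret Y: linear "sqrt_iter B n" using Suc by simp
  show ?case by (rule linearI) (simp_all add: B.add Y.add B.scale Y.scale algebra_simps)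
qed

lemma sqrt_iter_bound:
  fixes B :: "'a::real_normed_vector \<Rightarrow> 'a"
  assumes "\<And>x. norm (B x) \<le> norm x"
  shows "norm (sqrt_iter B n x) \<le> sqrt_majorant n * norm x"
proof (induction n arbitrary: x)
  case (Suc n)
  let ?Y = "sqrt_iter B n" and ?y = "sqrt_majorant n"
  have "norm (?Y (?Y x)) \<le> ?y * (?y * norm x)"
    using Suc[of "?Y x"] mult_left_mono[OF Suc[of x], of ?y] sqrt_majorant_bounds[of n] by linarith
  then have "norm (B x + ?Y (?Y x)) \<le> norm x + ?y * (?y * norm x)"
    using norm_triangle_ineq[of "B x" "?Y (?Y x)"] assms[of x] by linarith
  then show ?case
    unfolding sqrt_iter.simps norm_scaleR by (simp add: power2_eq_square algebra_simps)
qed simp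

lemma sqrt_iter_step:
  fixes B :: "'a::real_normed_vector \<Rightarrow> 'a"
  assumes "linear B" and "\<And>x. norm (B x) \<le> norm x"
  shows "norm (sqrt_iter B (Suc n) x - sqrt_iter B n x)
    \<le> (sqrt_majorant (Suc n) - sqrt_majorant n) * norm x"
proof (induction n arbitrary: x)
  case 0 show ?case using assms(2)[of x] by simp
next
  case (Suc n)
  define Y Z y z where defs: "Y = sqrt_iter B n" "Z = sqrt_iter B (Suc n)"
    "y = sqrt_majorant n" "z = sqrt_majorant (Suc n)"
  interpret Z: linear Z unfolding defs by (rule linear_sqrt_iter) fact
  have b: "0 \<le> y" "0 \<le> z" using sqrt_majorant_bounds unfolding defs by blast+
  have nY: "norm (Y x) \<le> y * norm x" for x unfolding defs by (rule sqrt_iter_bound) fact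
  have nZ: "norm (Z x) \<le> z * norm x" for x unfolding defs by (rule sqrt_iter_bound) fact
  have IH: "norm (Z x - Y x) \<le> (z - y) * norm x" for x using Suc[of x] unfolding defs .
  have zy: "0 \<le> z - y"
    using zero_le_power2[of "1 - y"] unfolding defs by (simp add: power2_eq_square field_simps)
  have "Z (Z x) - Y (Y x) = Z (Z x - Y x) + (Z (Y x) - Y (Y x))" by (simp add: Z.diff)
  also have "norm \<dots> \<le> z * ((z - y) * norm x) + (z - y) * (y * norm x)"
    by (rule norm_triangle_le, rule add_mono)
      (use nZ[of "Z x - Y x"] IH[of "Y x"] mult_left_mono[OF IH[of x] b(2)]
        mult_left_mono[OF nY[of x] zy] in linarith)+
  also have "\<dots> = (z\<^sup>2 - y\<^sup>2) * norm x" by (simp add: power2_eq_square algebra_simps)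
  finally have "norm (Z (Z x) - Y (Y x)) \<le> (z\<^sup>2 - y\<^sup>2) * norm x" .
  moreover have "sqrt_iter B (Suc (Suc n)) x - sqrt_iter B (Suc n) x = (1/2) *\<^sub>R (Z (Z x) - Y (Y x))"
    unfolding sqrt_iter.simps(2)[of B "Suc n" x] sqrt_iter.simps(2)[of B n x] defs
    by (simp only: scaleR_diff_right scaleR_add_right) simp
  moreover have "sqrt_majorant (Suc (Suc n)) - sqrt_majorant (Suc n) = (z\<^sup>2 - y\<^sup>2) / 2"
    unfolding sqrt_majorant.simps(2)[of "Suc n"] defs by (simp add: field_simps)
  ultimately show ?case
    unfolding \<open>sqrt_iter B (Suc (Suc n)) x - _ = _\<close> \<open>sqrt_majorant (Suc (Suc n)) - _ = _\<close>
      norm_scaleR by simp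
qed

lemma sqrt_iter_convergent:
  fixes B :: "'a::{real_inner, complete_space} \<Rightarrow> 'a"
  assumes "linear B" and "\<And>x. norm (B x) \<le> norm x"
  shows "convergent (\<lambda>n. sqrt_iter B n x)"
proof -
  have step: "norm (sqrt_iter B (m + k) x - sqrt_iter B m x)
      \<le> (sqrt_majorant (m + k) - sqrt_majorant m) * norm x" for m k
  proof (induction k)
    case (Suc k)
    have "norm (sqrt_iter B (m + Suc k) x - sqrt_iter B m x)
       \<le> norm (sqrt_iter B (Suc (m + k)) x - sqrt_iter B (m + k) x)
        + norm (sqrt_iter B (m + k) x - sqrt_iter B m x)"
      using norm_triangle_ineq[of "sqrt_iter B (Suc (m + k)) x - sqrt_iter B (m + k) x"
          "sqrt_iter B (m + k) x - sqrt_iter B m x"] by (simp del: sqrt_iter.simps)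
    also have "\<dots> \<le> (sqrt_majorant (m + Suc k) - sqrt_majorant m) * norm x"
      using sqrt_iter_step[OF assms, of "m + k" x] Suc
      by (simp del: sqrt_iter.simps sqrt_majorant.simps add: algebra_simps)
    finally show ?case .
  qed simp
  have C: "Cauchy sqrt_majorant" using sqrt_majorant_convergent by (rule convergent_Cauchy)
  have "Cauchy (\<lambda>n. sqrt_iter B n x)"
  proof (rule CauchyI')
    fix e :: real assume e: "0 < e"
    then have "0 < e / (norm x + 1)" by (simp add: add_nonneg_pos)
    then obtain M where M: "\<And>m n. m \<ge> M \<Longrightarrow> n \<ge> M \<Longrightarrow>
        norm (sqrt_majorant m - sqrt_majorant n) < e / (norm x + 1)"
      using CauchyD[OF C] by meson
    have "norm (sqrt_iter B m x - sqrt_iter B n x) < e" if "M \<le> m" "m < n" for m n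
    proof -
      obtain k where k: "n = m + k" using \<open>m < n\<close> less_imp_add_positive by blast
      have "norm (sqrt_iter B m x - sqrt_iter B n x) \<le> (sqrt_majorant n - sqrt_majorant m) * norm x"
        using step[of m k] k by (simp add: norm_minus_commute)
      also have "\<dots> \<le> e / (norm x + 1) * norm x"
        using M[of n m] that by (intro mult_right_mono) auto
      also have "\<dots> < e" using e by (simp add: divide_less_eq add_nonneg_pos)
      finally show ?thesis .
    qed
    then show "\<exists>M. \<forall>m\<ge>M. \<forall>n>m. dist (sqrt_iter B m x) (sqrt_iter B n x) < e"
      unfolding dist_norm by blast
  qed
  then show ?thesis by (rule Cauchy_convergent)
qed

lemma self_adjoint_sqrt_iter:
  assumes "self_adjoint B" shows "self_adjoint (sqrt_iter B n)"
  using assms by (induction n) (simp_all add: self_adjoint_def inner_add_left inner_add_right)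

lemma sqrt_iter_commute:
  assumes "linear C" and "\<And>x. C (B x) = B (C x)"
  shows "C (sqrt_iter B n x) = sqrt_iter B n (C x)"
proof (induction n arbitrary: x)
  interpret C: linear C by fact
  { case 0 show ?case by (simp add: C.zero) }
  { case (Suc n) then show ?case by (simp add: C.add C.scale assms(2)) }
qed

text \<open>Cauchy--Schwarz for the form \<open>\<langle>T x, y\<rangle>\<close>, which is only semidefinite; the degenerate
  case \<open>\<langle>T y, y\<rangle> = 0\<close> is treated apart.\<close>

lemma nonneg_op_Cauchy_Schwarz:
  assumes "linear T" and "self_adjoint T" and "nonneg_op T"
  shows "(inner (T x) y)\<^sup>2 \<le> inner (T x) x * inner (T y) y"
proof -
  interpret T: linear T by fact
  have sym: "inner (T y) x = inner (T x) y" for x y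
    using assms(2) by (simp add: self_adjoint_def inner_commute)
  have q: "0 \<le> inner (T x) x + 2 * t * inner (T x) y + t\<^sup>2 * inner (T y) y" for t
  proof -
    have "0 \<le> inner (T (x + t *\<^sub>R y)) (x + t *\<^sub>R y)" using assms(3) by (simp add: nonneg_op_def)
    also have "\<dots> = inner (T x) x + 2 * t * inner (T x) y + t\<^sup>2 * inner (T y) y"
      using sym[of x y]
      by (simp add: T.add T.scale inner_add_left inner_add_right power2_eq_square algebra_simps)
    finally show ?thesis .
  qed
  have pos: "0 \<le> inner (T y) y" using assms(3) by (simp add: nonneg_op_def)
  show ?thesis
  proof (cases "inner (T y) y = 0")
    case True
    have "inner (T x) y = 0"
    proof (rule ccontr)
      assume *: "inner (T x) y \<noteq> 0"
      show False
        using q[of "- (inner (T x) x + 1) / (2 * inner (T x) y)"] True * by (simp add: field_simps)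
    qed
    then show ?thesis using True by simp
  next
    case False
    then have "0 < inner (T y) y" using pos by simp
    then show ?thesis
      using q[of "- inner (T x) y / inner (T y) y"]
      by (simp add: power2_eq_square field_simps)
  qed
qed

lemma nonneg_op_eq_0:
  assumes "linear T" and "self_adjoint T" and "nonneg_op T" and "inner (T x) x = 0"
  shows "T x = 0"
  using nonneg_op_Cauchy_Schwarz[OF assms(1-3), of x "T x"] assms(4) by simp

lemma nonneg_op_contraction:
  assumes "linear T" and "self_adjoint T" and "nonneg_op T"
    and "\<And>x. inner (T x) x \<le> inner x x"
  shows "norm (T x) \<le> norm x"
proof -
  have "(inner (T x) (T x))\<^sup>2 \<le> inner (T x) x * inner (T (T x)) (T x)"
    by (rule nonneg_op_Cauchy_Schwarz) fact+
  also have "\<dots> \<le> inner x x * inner (T x) (T x)"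
    by (rule mult_mono) (use assms in \<open>auto simp: nonneg_op_def\<close>)
  finally have "inner (T x) (T x) * inner (T x) (T x) \<le> inner x x * inner (T x) (T x)"
    by (simp add: power2_eq_square)
  then have "inner (T x) (T x) \<le> inner x x"
    by (metis inner_ge_zero inner_gt_zero_iff mult_right_le_imp_le order_le_less)
  then show ?thesis by (simp add: norm_eq_sqrt_inner)
qed

text \<open>After scaling \<open>Q\<close> below the identity, \<open>B = 1 - Q / c\<close> is a self-adjoint contraction and
  the limit \<open>Y\<close> of the iteration gives the root \<open>\<surd>c (1 - Y)\<close>. That the root commutes with everything
  that commutes with \<open>Q\<close> is what makes uniqueness provable.\<close>

lemma sqrt_exists:
  fixes Q :: "'a::{real_inner, complete_space} \<Rightarrow> 'a"
  assumes Q: "bounded_linear Q" "self_adjoint Q" "nonneg_op Q"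
  shows "\<exists>S. bounded_linear S \<and> self_adjoint S \<and> nonneg_op S \<and> S \<circ> S = Q \<and>
    (\<forall>C. bounded_linear C \<and> C \<circ> Q = Q \<circ> C \<longrightarrow> C \<circ> S = S \<circ> C)"
proof -
  interpret Q: bounded_linear Q by fact
  define c where "c = onorm Q + 1"
  have c: "c > 0" "onorm Q \<le> c" unfolding c_def using onorm_pos_le[OF Q(1)] by auto
  define B where "B x = x - (1/c) *\<^sub>R Q x" for x
  have linB: "linear B" unfolding B_def
    by (rule linearI) (simp_all add: Q.add Q.scaleR algebra_simps)
  have saB: "self_adjoint B" using Q(2)
    by (simp add: B_def self_adjoint_def inner_diff_left inner_diff_right)
  have "inner (Q x) x \<le> c * inner x x" for x
  proof -
    have "inner (Q x) x \<le> norm (Q x) * norm x" by (rule norm_cauchy_schwarz)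
    also have "\<dots> \<le> (c * norm x) * norm x"
      using order_trans[OF onorm[OF Q(1), of x] mult_right_mono[OF c(2) norm_ge_zero[of x]]]
      by (rule mult_right_mono) simp
    finally show ?thesis by (simp add: power2_norm_eq_inner[symmetric] power2_eq_square)
  qed
  then have nnB: "nonneg_op B"
    using c(1) by (simp add: B_def nonneg_op_def inner_diff_left field_simps)
  have leB: "inner (B x) x \<le> inner x x" for x
    using Q(3) c(1) by (simp add: B_def nonneg_op_def inner_diff_left)
  have ctr: "norm (B x) \<le> norm x" for x by (rule nonneg_op_contraction) fact+
  define Y where "Y x = lim (\<lambda>n. sqrt_iter B n x)" for x
  have lim: "(\<lambda>n. sqrt_iter B n x) \<longlonglongrightarrow> Y x" for x
    using sqrt_iter_convergent[OF linB ctr] unfolding Y_def convergent_LIMSEQ_iff by blast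
  have lin: "linear (sqrt_iter B n)" for n by (rule linear_sqrt_iter) fact
  have linY: "linear Y"
  proof (rule linearI)
    show "Y (x + y) = Y x + Y y" for x y
      using LIMSEQ_unique[OF lim[of "x + y"]] tendsto_add[OF lim[of x] lim[of y]]
      by (simp add: linear_add[OF lin])
    show "Y (r *\<^sub>R x) = r *\<^sub>R Y x" for r x
      using LIMSEQ_unique[OF lim[of "r *\<^sub>R x"]] tendsto_scaleR[OF tendsto_const lim[of x]]
      by (simp add: linear_scale[OF lin])
  qed
  have ctr_n: "norm (sqrt_iter B n x) \<le> norm x" for n x
    using sqrt_iter_bound[OF ctr, of n x] sqrt_majorant_bounds[of n]
    by (meson mult_left_le_one_le norm_ge_zero order_trans)
  have ctrY: "norm (Y x) \<le> norm x" for x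
    by (rule LIMSEQ_le_const2[OF tendsto_norm[OF lim]]) (use ctr_n in auto)
  have saY: "self_adjoint Y" unfolding self_adjoint_def
  proof (intro allI)
    fix x y
    have "(\<lambda>n. inner (sqrt_iter B n x) y) \<longlonglongrightarrow> inner (Y x) y" by (intro tendsto_intros lim)
    moreover have "inner (sqrt_iter B n x) y = inner x (sqrt_iter B n y)" for n
      using self_adjoint_sqrt_iter[OF saB] unfolding self_adjoint_def by blast
    moreover have "(\<lambda>n. inner x (sqrt_iter B n y)) \<longlonglongrightarrow> inner x (Y y)" by (intro tendsto_intros lim)
    ultimately show "inner (Y x) y = inner x (Y y)"
      using LIMSEQ_unique by simp
  qed
  have lim2: "(\<lambda>n. sqrt_iter B n (sqrt_iter B n x)) \<longlonglongrightarrow> Y (Y x)" for x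
  proof -
    have "(\<lambda>n. sqrt_iter B n (sqrt_iter B n x - Y x)) \<longlonglongrightarrow> 0"
    proof (rule tendsto_norm_zero_cancel, rule tendsto_sandwich[OF _ _ tendsto_const])
      show "(\<lambda>n. norm (sqrt_iter B n x - Y x)) \<longlonglongrightarrow> 0"
        using lim[of x] by (simp add: LIM_zero tendsto_norm_zero)
    qed (use ctr_n in auto)
    from tendsto_add[OF this lim[of "Y x"]] show ?thesis by (simp add: linear_diff[OF lin])
  qed
  have eqY: "Y x = (1/2) *\<^sub>R (B x + Y (Y x))" for x
  proof (rule LIMSEQ_unique)
    show "(\<lambda>n. sqrt_iter B (Suc n) x) \<longlonglongrightarrow> Y x" using lim[of x] by (rule LIMSEQ_Suc)
    show "(\<lambda>n. sqrt_iter B (Suc n) x) \<longlonglongrightarrow> (1/2) *\<^sub>R (B x + Y (Y x))"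
      unfolding sqrt_iter.simps by (intro tendsto_intros lim2)
  qed
  define S where "S x = sqrt c *\<^sub>R (x - Y x)" for x
  have eqS: "S (S x) = Q x" for x
  proof -
    have "2 *\<^sub>R Y x = B x + Y (Y x)" by (subst eqY) simp
    then have "x - 2 *\<^sub>R Y x + Y (Y x) = (1/c) *\<^sub>R Q x" by (simp add: B_def)
    moreover have "S (S x) = (sqrt c * sqrt c) *\<^sub>R (x - 2 *\<^sub>R Y x + Y (Y x))"
      by (simp only: S_def linear_diff[OF linY] linear_scale[OF linY] scaleR_2
          scaleR_scaleR[symmetric] scaleR_diff_right scaleR_add_right) simp
    ultimately show ?thesis using c(1) by simp
  qed
  show ?thesis
  proof (intro exI[of _ S] conjI allI impI)
    have linS: "linear S" unfolding S_def
      by (rule linearI) (simp_all add: linear_add[OF linY] linear_scale[OF linY] algebra_simps)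
    have "norm (S x) \<le> norm x * (2 * sqrt c)" for x
      using norm_triangle_ineq4[of x "Y x"] ctrY[of x] c(1) by (simp add: S_def)
    then show "bounded_linear S"
      using linS by (intro bounded_linear_intro[where K = "2 * sqrt c"]) (auto simp: linear_add linear_scale)
    show "self_adjoint S"
      using saY by (simp add: S_def self_adjoint_def inner_diff_left inner_diff_right)
    have "inner (Y x) x \<le> inner x x" for x
      using norm_cauchy_schwarz[of "Y x" x] mult_right_mono[OF ctrY[of x] norm_ge_zero[of x]]
      by (simp add: power2_norm_eq_inner[symmetric] power2_eq_square)
    then show "nonneg_op S" using c(1) by (simp add: S_def nonneg_op_def inner_diff_left)
    show "S \<circ> S = Q" using eqS by auto
    fix C :: "'a \<Rightarrow> 'a" assume "bounded_linear C \<and> C \<circ> Q = Q \<circ> C"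
    then have C: "bounded_linear C" "C \<circ> Q = Q \<circ> C" by auto
    interpret C: bounded_linear C by fact
    have "C (B x) = B (C x)" for x
      using fun_cong[OF C(2), of x] by (simp add: B_def C.diff C.scaleR)
    note comm = sqrt_iter_commute[OF C.linear, of B, OF this]
    have "(\<lambda>n. C (sqrt_iter B n x)) \<longlonglongrightarrow> C (Y x)" for x by (intro C.tendsto lim)
    then have "C (Y x) = Y (C x)" for x
      unfolding comm using lim LIMSEQ_unique by blast
    then show "C \<circ> S = S \<circ> C" by (simp add: S_def C.diff C.scaleR fun_eq_iff)
  qed
qed

text \<open>With \<open>y = (S - T) x\<close>, commutation gives \<open>(S + T) y = (S\<^sup>2 - T\<^sup>2) x = 0\<close>; both forms are
  nonnegative, so \<open>S y = T y = 0\<close> and \<open>\<parallel>y\<parallel>\<^sup>2 = \<langle>(S - T) y, x\<rangle> = 0\<close>.\<close>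

lemma sqrt_unique:
  assumes S: "bounded_linear S" "self_adjoint S" "nonneg_op S"
    and T: "bounded_linear T" "self_adjoint T" "nonneg_op T"
    and eq: "S \<circ> S = T \<circ> T" and comm: "\<And>x. S (T x) = T (S x)"
  shows "S = T"
proof
  fix x
  interpret S: bounded_linear S by fact
  interpret T: bounded_linear T by fact
  define y where "y = S x - T x"
  have sq: "S (S z) = T (T z)" for z using eq by (metis comp_apply)
  have "S y + T y = 0" unfolding y_def S.diff T.diff using comm sq by simp
  then have "inner (S y) y + inner (T y) y = 0" by (metis inner_add_left inner_zero_left)
  then have "inner (S y) y = 0" "inner (T y) y = 0"
    using S(3) T(3) by (auto simp: nonneg_op_def add_nonneg_eq_0_iff)
  then have "S y = 0" "T y = 0"
    using S T by (auto intro: nonneg_op_eq_0 bounded_linear.linear)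
  then have "inner (S x) y = 0" "inner (T x) y = 0"
    using S(2) T(2) by (simp_all add: self_adjoint_def)
  then have "inner y y = 0" by (simp add: y_def inner_diff_left)
  then show "S x = T x" by (simp add: y_def)
qed

text \<open>Any root commutes with its square, hence with the root constructed above, and so coincides
  with it.\<close>

lemma op_sqrt_eqI:
  fixes S :: "'a::{real_inner, complete_space} \<Rightarrow> 'a"
  assumes S: "bounded_linear S" "self_adjoint S" "nonneg_op S" "S \<circ> S = Q"
  shows "op_sqrt Q = S"
  unfolding op_sqrt_def
proof (rule the_equality)
  interpret S: bounded_linear S by fact
  have "bounded_linear Q"
    using bounded_linear_compose[OF S(1) S(1)] S(4) by (simp add: comp_def)
  moreover have "self_adjoint Q" using S(2) unfolding S(4)[symmetric] by (simp add: self_adjoint_def)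
  moreover have "nonneg_op Q"
    
  proof -
    have "inner (S (S x)) x = inner (S x) (S x)" for x using S(2) by (simp add: self_adjoint_def)
    then show ?thesis unfolding S(4)[symmetric] by (simp add: nonneg_op_def)
  qed
  ultimately obtain T where T: "bounded_linear T" "self_adjoint T" "nonneg_op T" "T \<circ> T = Q"
    "\<And>C. bounded_linear C \<Longrightarrow> C \<circ> Q = Q \<circ> C \<Longrightarrow> C \<circ> T = T \<circ> C"
    using sqrt_exists by metis
  have eq: "U = T" if "bounded_linear U" "self_adjoint U" "nonneg_op U" "U \<circ> U = Q" for U
  proof (rule sqrt_unique)
    have "U \<circ> T = T \<circ> U"
      by (rule T(5)) (simp_all add: that(1) flip: that(4) add: comp_assoc)
    then show "U (T x) = T (U x)" for x by (simp add: fun_eq_iff)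
  qed (use that T in auto)
  show "U = S" if "bounded_linear U \<and> self_adjoint U \<and> nonneg_op U \<and> U \<circ> U = Q" for U
    using eq[of U] eq[of S] S that by simp
qed (use S in simp)

lemma op_sqrt_props:
  fixes Q :: "'a::{real_inner, complete_space} \<Rightarrow> 'a"
  assumes "bounded_linear Q" "self_adjoint Q" "nonneg_op Q"
  shows "bounded_linear (op_sqrt Q)" "self_adjoint (op_sqrt Q)" "nonneg_op (op_sqrt Q)"
    "op_sqrt Q \<circ> op_sqrt Q = Q"
  using sqrt_exists[OF assms] op_sqrt_eqI by metis+

section \<open>Characteristic functions on a separable Hilbert space\<close>

text \<open>The algebra generated by the cosines \<open>cos (\<langle>x, k\<rangle> + c)\<close>, written as sums only: the product
  formula for cosines makes the sums closed under multiplication. Integrals over it depend linearly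
  on the characteristic function.\<close>

inductive trig_fun :: "('a::real_inner \<Rightarrow> real) \<Rightarrow> bool" where
  cos: "trig_fun (\<lambda>x. a * cos (inner x k + c))"
| add: "trig_fun p \<Longrightarrow> trig_fun q \<Longrightarrow> trig_fun (\<lambda>x. p x + q x)"

lemma trig_fun_const: "trig_fun (\<lambda>x. c)"
  using trig_fun.cos[of c 0 0] by simp

lemma trig_fun_mult:
  assumes "trig_fun p" and "trig_fun q"
  shows "trig_fun (\<lambda>x. p x * q x)"
  using assms
proof (induction p)
  case (cos a k c)
  from cos(1) show ?case
  proof (induction q)
    case (cos b l d)
    have eq: "a * cos (inner x k + c) * (b * cos (inner x l + d)) =
        (a * b / 2) * cos (inner x (k - l) + (c - d)) + (a * b / 2) * cos (inner x (k + l) + (c + d))" for x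
    proof -
      have "inner x (k - l) + (c - d) = (inner x k + c) - (inner x l + d)"
        "inner x (k + l) + (c + d) = (inner x k + c) + (inner x l + d)"
        by (simp_all add: inner_diff_right inner_add_right)
      moreover have "a * cos u * (b * cos v) = (a * b / 2) * cos (u - v) + (a * b / 2) * cos (u + v)" for u v
        unfolding cos_add cos_diff by (simp add: algebra_simps)
      ultimately show ?thesis by metis
    qed
    show ?case unfolding eq by (intro trig_fun.intros)
  next
    case (add p q)
    then show ?case by (simp add: distrib_left trig_fun.add)
  qed
next
  case (add p q)
  then show ?case by (simp add: distrib_right trig_fun.add)
qed

lemma trig_fun_continuous: "trig_fun p \<Longrightarrow> continuous_on S p"
  by (induction rule: trig_fun.induct) (auto intro!: continuous_intros)

lemma trig_fun_bounded: "trig_fun p \<Longrightarrow> \<exists>C. \<forall>x. \<bar>p x\<bar> \<le> C"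
proof (induction rule: trig_fun.induct)
  case (cos a k c)
  have "\<bar>a * cos (inner x k + c)\<bar> \<le> \<bar>a\<bar>" for x
    by (simp add: abs_mult mult_left_le)
  then show ?case by blast
next
  case (add p q)
  then obtain C D where "\<forall>x. \<bar>p x\<bar> \<le> C" "\<forall>x. \<bar>q x\<bar> \<le> D" by blast
  then have "\<bar>p x + q x\<bar> \<le> C + D" for x
    by (meson abs_triangle_ineq add_mono order_trans)
  then show ?case by blast
qed

lemma trig_fun_separates:
  assumes "x \<noteq> y" shows "\<exists>p. trig_fun p \<and> p x \<noteq> p y"
proof -
  define d where "d = inner (x - y) (x - y)"
  define k where "k = (pi / d) *\<^sub>R (x - y)"
  have "inner x k - inner y k = pi"
    using assms unfolding inner_diff_left[symmetric] by (simp add: k_def d_def)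
  then have "inner x k + (- inner y k) = pi" "inner y k + (- inner y k) = 0" by simp_all
  then have "1 * cos (inner x k + (- inner y k)) \<noteq> 1 * cos (inner y k + (- inner y k))"
    by (simp only:) simp
  with trig_fun.cos[of 1 k "- inner y k"] show ?thesis by blast
qed

lemma trig_fun_polynomial:
  assumes "real_polynomial_function (P :: real \<Rightarrow> real)" and "trig_fun p"
  shows "trig_fun (\<lambda>x. P (p x))"
  using assms(1)
proof induction
  case (linear f)
  then have "f = (\<lambda>x. f 1 * x)" by (auto simp: fun_eq_iff dest!: real_bounded_linear[THEN iffD1])
  then show ?case using trig_fun_mult[OF trig_fun_const assms(2)] by metis
qed (auto intro: trig_fun_const trig_fun.add trig_fun_mult)

text \<open>Stone--Weierstrass alone leaves the approximant uncontrolled off the compact set \<open>K\<close>. Composing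
  it with a polynomial close to the truncation to \<open>[-1, 1]\<close> restores a uniform bound on the whole space
  without leaving the algebra.\<close>

lemma trig_fun_approx:
  fixes f :: "'a::real_inner \<Rightarrow> real"
  assumes K: "compact K" and f: "continuous_on K f" "\<And>x. x \<in> K \<Longrightarrow> \<bar>f x\<bar> \<le> 1" and e: "0 < e"
  obtains q where "trig_fun q" "\<And>x. x \<in> K \<Longrightarrow> \<bar>f x - q x\<bar> < e" "\<And>x. \<bar>q x\<bar> < 1 + e"
proof -
  have ring: "function_ring_on (Collect trig_fun) K"
    by unfold_locales
      (auto intro: K trig_fun_continuous trig_fun_const trig_fun.add trig_fun_mult
        dest: trig_fun_separates)
  obtain p where p: "trig_fun p" "\<And>x. x \<in> K \<Longrightarrow> \<bar>f x - p x\<bar> < e / 2"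
    using function_ring_on.Stone_Weierstrass_basic[OF ring f(1), of "e / 2"] e by auto
  obtain C where C: "\<And>x. \<bar>p x\<bar> \<le> C" using trig_fun_bounded[OF p(1)] by blast
  \<comment> \<open>Truncation is approximated by a polynomial on the range of \<open>p\<close>, which is bounded.\<close>
  define clip where "clip t = max (-1) (min 1 t)" for t :: real
  have "continuous_on {-C..C} clip" unfolding clip_def by (intro continuous_intros)
  then obtain P where P: "real_polynomial_function P" "\<And>t. t \<in> {-C..C} \<Longrightarrow> \<bar>clip t - P t\<bar> < e / 2"
    using Stone_Weierstrass_real_polynomial_function[of "{-C..C}" clip "e / 2"] e by auto
  have P': "\<bar>clip (p x) - P (p x)\<bar> < e / 2" for x using C[of x] by (intro P(2)) auto
  show ?thesis
  proof (rule that)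
    show "trig_fun (\<lambda>x. P (p x))" by (rule trig_fun_polynomial) fact+
    show "\<bar>f x - P (p x)\<bar> < e" if "x \<in> K" for x
      using p(2)[OF that] f(2)[OF that] P'[of x]
      by (simp add: clip_def max_def min_def abs_if split: if_splits)
    show "\<bar>P (p x)\<bar> < 1 + e" for x
      using P'[of x] e by (simp add: clip_def max_def min_def abs_if split: if_splits)
  qed
qed

text \<open>Ulam's tightness theorem, read off from inner regularity.\<close>

lemma compact_exhaustion:
  fixes M :: "'a::polish_space measure"
  assumes "sets M = sets borel" and "finite_measure M" and "0 < e"
  obtains K where "compact K" "measure M (- K) < e"
proof -
  interpret finite_measure M by fact
  have sp: "space M = UNIV" using sets_eq_imp_space_eq[OF assms(1)] by simp
  have reg: "emeasure M UNIV = (SUP K \<in> {K. K \<subseteq> UNIV \<and> compact K}. emeasure M K)"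
    by (rule inner_regular) (use assms sp in auto)
  have "\<exists>K. compact K \<and> measure M UNIV < measure M K + e"
  proof (cases "measure M UNIV = 0")
    case True then show ?thesis using assms(3) by (intro exI[of _ "{}"]) auto
  next
    case False
    then have "ennreal (measure M UNIV - e) < emeasure M UNIV"
      unfolding emeasure_eq_measure using assms(3) by (intro ennreal_lessI) (auto simp: less_le)
    then obtain K where "compact K" "ennreal (measure M UNIV - e) < emeasure M K"
      unfolding reg less_SUP_iff by auto
    then show ?thesis unfolding emeasure_eq_measure
      by (intro exI[of _ K]) (simp add: ennreal_less_iff  split: if_splits, smt (verit) ennreal_less_iff ennreal_neg ennreal_eq_0_iff measure_nonneg not_less_zero)
  qed
  then obtain K where K: "compact K" "measure M UNIV < measure M K + e" by blast
  have "K \<in> sets M" using K(1) assms(1) by (simp add: compact_imp_closed)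
  then have "measure M (- K) = measure M UNIV - measure M K"
    using finite_measure_compl[of K] sp by (simp add: Compl_eq_Diff_UNIV)
  then show ?thesis using K that by auto
qed

text \<open>Indicators of open sets \<open>U\<close> are limits of the functions \<open>min 1 (n dist(x, -U))\<close>. The case
  \<open>U = UNIV\<close> is separate because the distance to the empty set is zero by convention.\<close>

lemma measure_eqI_continuous:
  fixes M N :: "'a::metric_space measure"
  assumes M: "sets M = sets borel" "finite_measure M"
    and N: "sets N = sets borel" "finite_measure N"
    and eq: "\<And>f :: 'a \<Rightarrow> real. continuous_on UNIV f \<Longrightarrow> (\<And>x. 0 \<le> f x \<and> f x \<le> 1) \<Longrightarrow>
      (\<integral>x. f x \<partial>M) = (\<integral>x. f x \<partial>N)"
  shows "M = N"
proof -
  have U: "measure M U = measure N U" if "open U" for U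
  proof -
    define f where "f n x = min 1 (real n * infdist x (- U))" for n x
    have f: "continuous_on UNIV (f n)" "\<And>x. 0 \<le> f n x \<and> f n x \<le> 1" for n
      unfolding f_def by (auto intro!: continuous_intros simp: infdist_nonneg)
    have lim: "(\<lambda>n. f n x) \<longlonglongrightarrow> indicator U x" if "- U \<noteq> {}" for x
    proof (cases "x \<in> U")
      case True
      then have "0 < infdist x (- U)"
        using in_closed_iff_infdist_zero[of "- U" x] \<open>open U\<close> that infdist_nonneg[of x "- U"] by force
      then obtain n0 where n0: "1 < real n0 * infdist x (- U)" using reals_Archimedean3 by blast
      have "f n x = 1" if "n \<ge> n0" for n
      proof -
        have "real n0 * infdist x (- U) \<le> real n * infdist x (- U)"
          using that by (intro mult_right_mono) (auto simp: infdist_nonneg)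
        then show ?thesis using n0 by (simp add: f_def)
      qed
      then have "\<forall>\<^sub>F n in sequentially. f n x = indicator U x"
        unfolding eventually_sequentially using True by (intro exI[of _ n0]) simp
      then show ?thesis by (rule tendsto_eventually)
    next
      case False
      then show ?thesis by (simp add: f_def)
    qed
    have conv: "(\<lambda>n. \<integral>x. f n x \<partial>L) \<longlonglongrightarrow> measure L U"
      if L: "sets L = sets borel" "finite_measure L" "- U \<noteq> {}" for L
    proof -
      interpret finite_measure L by fact
      have sp: "space L = UNIV" using sets_eq_imp_space_eq[OF L(1)] by simp
      have "(\<lambda>n. \<integral>x. f n x \<partial>L) \<longlonglongrightarrow> (\<integral>x. indicator U x \<partial>L)"
      proof (rule integral_dominated_convergence[where w = "\<lambda>_. 1"])
        show "f n \<in> borel_measurable L" for n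
          using borel_measurable_continuous_onI[OF f(1)] by (simp add: measurable_cong_sets[OF L(1) refl])
        show "(indicator U :: 'a \<Rightarrow> real) \<in> borel_measurable L"
          using \<open>open U\<close> by (intro borel_measurable_indicator) (simp add: L(1))
      qed (use f lim L(3) in auto)
      then show ?thesis using sp by simp
    qed
    show ?thesis
    proof (cases "- U = {}")
      case True
      then have "U = UNIV" by auto
      then show ?thesis using eq[of "\<lambda>_. 1"] M N by (simp add: sets_eq_imp_space_eq[OF M(1)] sets_eq_imp_space_eq[OF N(1)])
    next
      case False
      show ?thesis
        using LIMSEQ_unique[OF conv[OF M False]] conv[OF N False] eq[OF f] by simp
    qed
  qed
  interpret M: finite_measure M by fact
  interpret N: finite_measure N by fact
  show ?thesis
  proof (rule measure_eqI_generator_eq[where E = "{U. open U}" and A = "\<lambda>_. UNIV" and \<Omega> = UNIV])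
    show "sets M = sigma_sets UNIV {U. open U}" "sets N = sigma_sets UNIV {U. open U}"
      by (simp_all add: M N borel_def)
    show "Int_stable {U::'a set. open U}" by (auto intro: Int_stableI)
  qed (auto simp: M.emeasure_eq_measure N.emeasure_eq_measure U)
qed

text \<open>A continuous function is replaced by a trigonometric one that is close to it on a
  compact set carrying almost all the mass of both measures, and bounded elsewhere.\<close>

theorem measure_eqI_cos:
  fixes M N :: "'a::{real_inner, polish_space} measure"
  assumes M: "sets M = sets borel" "finite_measure M"
    and N: "sets N = sets borel" "finite_measure N"
    and eq: "\<And>k c. (\<integral>x. cos (inner x k + c) \<partial>M) = (\<integral>x. cos (inner x k + c) \<partial>N)"
  shows "M = N"
proof (rule measure_eqI_continuous[OF M N])
  fix f :: "'a \<Rightarrow> real" assume f: "continuous_on UNIV f" "\<And>x. 0 \<le> f x \<and> f x \<le> 1"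
  interpret M: finite_measure M by fact
  interpret N: finite_measure N by fact
  have bint: "integrable L g" if "sets L = sets borel" "finite_measure L"
    "continuous_on UNIV g" "\<And>x. \<bar>g x\<bar> \<le> C" for L and g :: "'a \<Rightarrow> real" and C
    using that(2) borel_measurable_continuous_onI[OF that(3)] that(4)
    by (intro finite_measure.integrable_const_bound[where B = C])
       (auto simp: measurable_cong_sets[OF that(1) refl])
  have trig: "integrable M p \<and> integrable N p \<and> (\<integral>x. p x \<partial>M) = (\<integral>x. p x \<partial>N)" if "trig_fun p" for p
    using that
  proof (induction rule: trig_fun.induct)
    case (cos a k c)
    have "integrable L (\<lambda>x. cos (inner x k + c))" if "sets L = sets borel" "finite_measure L" for L
      by (rule bint[OF that, where C = 1]) (auto intro!: continuous_intros)
    then show ?case using M N by (simp add: eq)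
  qed auto
  define T where "T = measure M UNIV + measure N UNIV + 1"
  have T: "T > 0" unfolding T_def by (simp add: add_nonneg_pos)
  \<comment> \<open>On the compact set the error is at most \<open>e\<close>; off it, \<open>\<bar>f - q\<bar> \<le> 3\<close> on a set of mass less than \<open>e\<close>. Both measures contribute, whence \<open>T + 6\<close>.\<close>
  have close: "\<bar>(\<integral>x. f x \<partial>M) - (\<integral>x. f x \<partial>N)\<bar> \<le> e * (T + 6)" if e: "0 < e" "e < 1" for e
  proof -
    obtain K1 where K1: "compact K1" "measure M (- K1) < e" by (rule compact_exhaustion[OF M e(1)])
    obtain K2 where K2: "compact K2" "measure N (- K2) < e" by (rule compact_exhaustion[OF N e(1)])
    define K where "K = K1 \<union> K2"
    have K: "compact K" unfolding K_def using K1 K2 by blast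
    obtain q where q: "trig_fun q" "\<And>x. x \<in> K \<Longrightarrow> \<bar>f x - q x\<bar> < e" "\<And>x. \<bar>q x\<bar> < 1 + e"
      using trig_fun_approx[OF K continuous_on_subset[OF f(1)] _ e(1)] f(2) by (metis abs_of_nonneg subset_UNIV)
    have near: "\<bar>(\<integral>x. f x \<partial>L) - (\<integral>x. q x \<partial>L)\<bar> \<le> e * measure L UNIV + 3 * e"
      if L: "sets L = sets borel" "finite_measure L" "C \<subseteq> K" "compact C" "measure L (- C) < e" for L C
    proof -
      interpret finite_measure L by fact
      have sp: "space L = UNIV" using sets_eq_imp_space_eq[OF L(1)] by simp
      have C: "- C \<in> sets L" using L(1,4) by (simp add: compact_imp_closed open_Compl)
      have i: "integrable L f" "integrable L q"
        using bint[OF L(1,2) f(1), of 1] f(2) bint[OF L(1,2) trig_fun_continuous[OF q(1)], of "1 + e"] q(3)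
        by (auto simp: less_imp_le)
      have i2: "integrable L (\<lambda>x. e + 3 * indicator (- C) x)" using C by (simp add: emeasure_eq_measure)
      have "\<bar>(\<integral>x. f x \<partial>L) - (\<integral>x. q x \<partial>L)\<bar> = \<bar>\<integral>x. f x - q x \<partial>L\<bar>" using i by simp
      also have "\<dots> \<le> (\<integral>x. \<bar>f x - q x\<bar> \<partial>L)" by (rule integral_abs_bound)
      also have "\<dots> \<le> (\<integral>x. e + 3 * indicator (- C) x \<partial>L)"
      proof (rule integral_mono)
        show "\<bar>f x - q x\<bar> \<le> e + 3 * indicator (- C) x" for x
          using q(2)[of x] q(3)[of x] f(2)[of x] e L(3) by (cases "x \<in> C") auto
      qed (use i i2 in auto)
      also have "\<dots> = e * measure L UNIV + 3 * measure L (- C)"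
        using C sp by (subst Bochner_Integration.integral_add) (auto simp: emeasure_eq_measure)
      finally show ?thesis using L(5) by simp
    qed
    have "\<bar>(\<integral>x. f x \<partial>M) - (\<integral>x. f x \<partial>N)\<bar> \<le> (e * measure M UNIV + 3 * e) + (e * measure N UNIV + 3 * e)"
      using near[OF M _ K1] near[OF N _ K2] trig[OF q(1)] unfolding K_def by auto
    also have "\<dots> \<le> e * (T + 6)" using e by (simp add: T_def algebra_simps)
    finally show ?thesis .
  qed
  show "(\<integral>x. f x \<partial>M) = (\<integral>x. f x \<partial>N)"
  proof (rule ccontr)
    define d where "d = \<bar>(\<integral>x. f x \<partial>M) - (\<integral>x. f x \<partial>N)\<bar>"
    assume "(\<integral>x. f x \<partial>M) \<noteq> (\<integral>x. f x \<partial>N)"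
    then have d: "d > 0" by (simp add: d_def)
    define e where "e = min (1/2) (d / (2 * (T + 6)))"
    have e: "0 < e" "e < 1" using d T by (auto simp: e_def)
    have "e * (T + 6) \<le> d / (2 * (T + 6)) * (T + 6)"
      using T by (intro mult_right_mono) (auto simp: e_def)
    also have "\<dots> = d / 2" using T by (simp add: divide_simps)
    also have "\<dots> < d" using d by simp
    finally show False using close[OF e] by (simp add: d_def)
  qed
qed

section \<open>The standard normal law\<close>

lemma prob_std: "prob_space std_normal_distribution"
  by (rule prob_space_normal_density) simp

text \<open>One description covers the Dirac laws (\<open>s = 0\<close>) and the nondegenerate ones.\<close>

lemma real_gaussian_affine:
  assumes "real_gaussian \<mu>"
  obtains m s where "\<mu> = distr std_normal_distribution borel (\<lambda>t. m + s * t)"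
proof -
  interpret N: prob_space std_normal_distribution by (rule prob_std)
  from assms consider m where "\<mu> = return borel m"
    | m s where "0 < s" "\<mu> = density lborel (\<lambda>x. ennreal (normal_density m s x))"
    unfolding real_gaussian_def by blast
  then show ?thesis
  proof cases
    case 1
    then have "\<mu> = distr std_normal_distribution borel (\<lambda>t. m + 0 * t)"
      using N.distr_const[of m borel] by simp
    then show ?thesis by (rule that)
  next
    case 2
    have "distributed std_normal_distribution lborel (\<lambda>t. t) (\<lambda>x. ennreal (std_normal_density x))"
      by (simp add: distributed_def distr_id2)
    from N.normal_density_affine[OF this, of s m] 2
    have "distr std_normal_distribution lborel (\<lambda>t. m + s * t) = \<mu>"
      by (simp add: distributed_def)
    then have "\<mu> = distr std_normal_distribution borel (\<lambda>t. m + s * t)"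
      by (metis distr_cong sets_lborel)
    then show ?thesis by (rule that)
  qed
qed

lemma std_moments:
  "integrable std_normal_distribution (\<lambda>t. t)" "(\<integral>t. t \<partial>std_normal_distribution) = 0"
  "integrable std_normal_distribution (\<lambda>t. t\<^sup>2)" "(\<integral>t. t\<^sup>2 \<partial>std_normal_distribution) = 1"
  using integrable_std_normal_distribution_moment[of 1] integral_std_normal_distribution_moment_odd[of 1]
    std_normal_distribution_even_moments[of 1] by simp_all

lemma std_cos: "(\<integral>t. cos (s * t + c) \<partial>std_normal_distribution) = cos c * exp (- s\<^sup>2 / 2)"
proof -
  interpret N: prob_space std_normal_distribution by (rule prob_std)
  have i: "integrable std_normal_distribution (\<lambda>t. cis (s * t))"
    by (rule N.integrable_const_bound[where B = 1]) (auto simp: cis_conv_exp)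
  have ch: "(CLINT t|std_normal_distribution. cis (s * t)) = complex_of_real (exp (- s\<^sup>2 / 2))"
    using fun_cong[OF char_std_normal_distribution, of s] unfolding char_def by (simp add: cis_conv_exp)
  have c: "(\<integral>t. cos (s * t) \<partial>std_normal_distribution) = exp (- s\<^sup>2 / 2)"
    using integral_Re[OF i] ch by simp
  have s: "(\<integral>t. sin (s * t) \<partial>std_normal_distribution) = 0"
    using integral_Im[OF i] ch by simp
  have "integrable std_normal_distribution (\<lambda>t. cos (s * t))" "integrable std_normal_distribution (\<lambda>t. sin (s * t))"
    by (rule N.integrable_const_bound[where B = 1]; simp)+
  then show ?thesis by (simp add: cos_add c s)
qed

text \<open>The density \<open>n\<close> satisfies \<open>n' = - t n\<close>, so \<open>(u n)' = (u' - t u) n\<close> integrates to zero.\<close>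

lemma std_normal_ibp:
  fixes u u' :: "real \<Rightarrow> real"
  assumes der: "\<And>t. (u has_real_derivative u' t) (at t)" and cont: "continuous_on UNIV u'"
    and bnd: "\<And>t. \<bar>u t\<bar> \<le> C" "\<And>t. \<bar>u' t\<bar> \<le> C"
  shows "(\<integral>t. u t * t \<partial>std_normal_distribution) = (\<integral>t. u' t \<partial>std_normal_distribution)"
proof -
  interpret N: prob_space std_normal_distribution by (rule prob_std)
  have cu: "continuous_on UNIV u" using der by (meson DERIV_isCont continuous_at_imp_continuous_on)
  have [measurable]: "u \<in> borel_measurable borel" "u' \<in> borel_measurable borel"
    using cu cont by (auto intro: borel_measurable_continuous_onI)
  have i1: "integrable std_normal_distribution u'"
    by (rule N.integrable_const_bound[where B = C]) (use bnd in auto)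
  have i2: "integrable std_normal_distribution (\<lambda>t. u t * t)"
  proof (rule Bochner_Integration.integrable_bound)
    show "integrable std_normal_distribution (\<lambda>t. C * t)" using std_moments by simp
    show "AE t in std_normal_distribution. norm (u t * t) \<le> norm (C * t)"
      using order_trans[OF bnd(1) abs_ge_self] by (simp add: abs_mult mult_right_mono)
  qed measurable
  have J: "integrable lborel (\<lambda>t. std_normal_density t * (u' t - u t * t))"
    using iffD1[OF integrable_density Bochner_Integration.integrable_diff[OF i1 i2]]
    by (simp add: normal_density_nonneg)
  define n where "n t = 1 / sqrt (2 * pi) * exp (- t\<^sup>2 / 2)" for t :: real
  have n: "std_normal_density = n" unfolding n_def std_normal_density_def by auto
  have dn: "(n has_real_derivative - t * n t) (at t)" for t
    unfolding n_def by (auto intro!: derivative_eq_intros simp: field_simps)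
  have dF: "((\<lambda>t. u t * n t) has_real_derivative n t * (u' t - u t * t)) (at t)" for t
    by (rule derivative_eq_intros der dn refl)+ (simp add: algebra_simps)
  have cn: "continuous_on UNIV n" unfolding n_def by (intro continuous_intros) simp_all
  have e0: "((\<lambda>t. C * (1 / sqrt (2 * pi) * exp (- t\<^sup>2 / 2))) \<longlongrightarrow> C * (1 / sqrt (2 * pi) * 0)) F"
    if "filterlim (\<lambda>t::real. t\<^sup>2) at_top F" for F
  proof (intro tendsto_intros filterlim_compose[OF exp_at_bot])
    have "filterlim (\<lambda>t::real. (- 1 / 2) * t\<^sup>2) at_bot F"
      by (rule filterlim_tendsto_neg_mult_at_bot[OF tendsto_const _ that]) simp
    then show "filterlim (\<lambda>t::real. - t\<^sup>2 / 2) at_bot F" by simp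
  qed
  have lim: "((\<lambda>t. u t * n t) \<longlongrightarrow> 0) F" if "filterlim (\<lambda>t::real. t\<^sup>2) at_top F" for F
  proof (rule Lim_null_comparison)
    show "((\<lambda>t. C * n t) \<longlongrightarrow> 0) F" using e0[OF that] unfolding n_def by simp
    have "0 \<le> n t" for t unfolding n_def by simp
    then show "\<forall>\<^sub>F t in F. norm (u t * n t) \<le> C * n t"
      using bnd(1) by (intro always_eventually allI) (simp add: abs_mult mult_right_mono)
  qed
  have "(LBINT t=-\<infinity>..\<infinity>. n t * (u' t - u t * t)) = 0 - 0"
  proof (rule interval_integral_FTC_integrable)
    show "((\<lambda>t. u t * n t) has_vector_derivative n t * (u' t - u t * t)) (at t)" for t
      using dF by (simp add: has_real_derivative_iff_has_vector_derivative)
    show "isCont (\<lambda>t. n t * (u' t - u t * t)) t" for t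
    proof -
      have "continuous_on UNIV (\<lambda>t. n t * (u' t - u t * t))" by (intro continuous_intros cn cu cont)
      then show ?thesis by (simp add: continuous_on_eq_continuous_at)
    qed
    show "set_integrable lborel (einterval (- \<infinity>) \<infinity>) (\<lambda>t. n t * (u' t - u t * t))"
      using J n by (simp add: set_integrable_def)
    show "(((\<lambda>t. u t * n t) \<circ> real_of_ereal) \<longlongrightarrow> 0) (at_right (- \<infinity>))"
      unfolding ereal_tendsto_simps by (rule lim) (intro filterlim_pow_at_bot_even filterlim_ident; simp)
    show "(((\<lambda>t. u t * n t) \<circ> real_of_ereal) \<longlongrightarrow> 0) (at_left \<infinity>)"
      unfolding ereal_tendsto_simps by (rule lim) (intro filterlim_pow_at_top filterlim_ident; simp)
  qed simp
  then have "(LBINT t. n t * (u' t - u t * t)) = 0" by (simp add: interval_lebesgue_integral_def set_lebesgue_integral_def einterval_def)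
  then have "(\<integral>t. u' t - u t * t \<partial>std_normal_distribution) = 0"
    unfolding n[symmetric] by (subst integral_density) (auto simp: normal_density_nonneg)
  then show ?thesis using i1 i2 by simp
qed

section \<open>Gaussian integration by parts\<close>

locale centered_gaussian =
  fixes \<gamma> :: "'a::{real_inner, polish_space} measure" and Q :: "'a \<Rightarrow> 'a"
  assumes gaussian: "gaussian_measure \<gamma>" and centered: "centered \<gamma>" and cov: "has_covariance \<gamma> Q"
begin

sublocale prob_space \<gamma> using gaussian by (simp add: gaussian_measure_def)

lemma sets_eq [measurable_cong]: "sets \<gamma> = sets borel"
  using gaussian by (simp add: gaussian_measure_def)

lemma space_eq [simp]: "space \<gamma> = UNIV" using sets_eq_imp_space_eq[OF sets_eq] by simp

lemma cov_sq: "inner (Q h) h = (\<integral>x. (inner x h)\<^sup>2 \<partial>\<gamma>)"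
  using cov by (simp add: has_covariance_def power2_eq_square)

lemma marginal:
  "distr \<gamma> borel (\<lambda>x. inner x h) = distr std_normal_distribution borel (\<lambda>t. sqrt (inner (Q h) h) * t)"
proof -
  interpret N: prob_space std_normal_distribution by (rule prob_std)
  have "real_gaussian (distr \<gamma> borel (\<lambda>x. inner x h))"
    using gaussian by (simp add: gaussian_measure_def)
  then obtain m s where ms: "distr \<gamma> borel (\<lambda>x. inner x h) = distr std_normal_distribution borel (\<lambda>t. m + s * t)"
    by (rule real_gaussian_affine)
  have tr: "(\<integral>x. g (inner x h) \<partial>\<gamma>) = (\<integral>t. g (m + s * t) \<partial>std_normal_distribution)"
    if [measurable]: "g \<in> borel_measurable borel" for g :: "real \<Rightarrow> real"
    using arg_cong[OF ms, of "\<lambda>M. integral\<^sup>L M g"] by (simp add: integral_distr)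
  have pr: "measure std_normal_distribution UNIV = 1" using N.prob_space by simp
  have "(\<integral>t. m + s * t \<partial>std_normal_distribution) = m"
    using std_moments pr by (subst Bochner_Integration.integral_add) auto
  then have m: "m = 0"
    using tr[of "\<lambda>t. t"] centered by (simp add: centered_def)
  have "inner (Q h) h = s\<^sup>2"
    using tr[of "\<lambda>t. t\<^sup>2"] std_moments(4) unfolding cov_sq[of h] m by (simp add: power_mult_distrib)
  then have "sqrt (inner (Q h) h) = \<bar>s\<bar>" by simp
  \<comment> \<open>The scale obtained above may be negative; the normal law is symmetric.\<close>
  moreover have "distr std_normal_distribution borel (\<lambda>t. s * t) = distr std_normal_distribution borel (\<lambda>t. \<bar>s\<bar> * t)"
  proof (cases "s < 0")
    case True
    have "distr std_normal_distribution borel (\<lambda>t. - t) = std_normal_distribution"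
    proof -
      have "distributed std_normal_distribution lborel (\<lambda>t. t) (\<lambda>x. ennreal (std_normal_density x))"
        by (simp add: distributed_def distr_id2)
      from N.normal_density_affine[OF this, of "-1" 0]
      have "distr std_normal_distribution lborel (\<lambda>t. - t) = std_normal_distribution"
        by (simp add: distributed_def)
      then show ?thesis by (metis distr_cong sets_lborel)
    qed
    then have "distr std_normal_distribution borel (\<lambda>t. s * t) = 
       distr (distr std_normal_distribution borel (\<lambda>t. - t)) borel (\<lambda>t. s * t)" by simp
    also have "\<dots> = distr std_normal_distribution borel (\<lambda>t. \<bar>s\<bar> * t)"
      using True by (subst distr_distr) (auto simp: comp_def intro!: distr_cong)
    finally show ?thesis .
  qed simp
  ultimately show ?thesis using ms m by simp
qed

lemma integrable_marginal:
  assumes [measurable]: "g \<in> borel_measurable borel"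
  shows "integrable \<gamma> (\<lambda>x. g (inner x h) :: real) \<longleftrightarrow>
    integrable std_normal_distribution (\<lambda>t. g (sqrt (inner (Q h) h) * t))"
  using arg_cong[OF marginal[of h], of "\<lambda>M. integrable M g"] by (simp add: integrable_distr_eq)

lemma integral_marginal:
  assumes [measurable]: "g \<in> borel_measurable borel"
  shows "(\<integral>x. g (inner x h) \<partial>\<gamma>) = (\<integral>t. g (sqrt (inner (Q h) h) * t) \<partial>std_normal_distribution :: real)"
  using arg_cong[OF marginal[of h], of "\<lambda>M. integral\<^sup>L M g"] by (simp add: integral_distr)

lemma integrable_inner: "integrable \<gamma> (\<lambda>x. inner x h)"
proof -
  have "integrable std_normal_distribution (\<lambda>t. sqrt (inner (Q h) h) * t)"
    by (intro integrable_mult_right std_moments)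
  then show ?thesis by (subst integrable_marginal[of "\<lambda>t. t" h]) auto
qed

lemma integrable_inner_sq: "integrable \<gamma> (\<lambda>x. (inner x h)\<^sup>2)"
proof -
  have "integrable std_normal_distribution (\<lambda>t. (sqrt (inner (Q h) h) * t)\<^sup>2)"
    unfolding power_mult_distrib by (intro integrable_mult_right std_moments)
  then show ?thesis by (subst integrable_marginal[of "\<lambda>t. t\<^sup>2" h]) auto
qed

lemma cov_nonneg: "0 \<le> inner (Q h) h" unfolding cov_sq by simp

lemma integral_cos: "(\<integral>x. cos (inner x k + c) \<partial>\<gamma>) = cos c * exp (- inner (Q k) k / 2)"
  using integral_marginal[of "\<lambda>t. cos (t + c)" k] std_cos[of "sqrt (inner (Q k) k)" c] cov_nonneg[of k]
  by simp

lemma Q_sym: "inner (Q h) k = inner (Q k) h"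
  using cov by (simp add: has_covariance_def mult.commute)

text \<open>When \<open>\<langle>Q h, h\<rangle> = 1\<close>, the vector \<open>x - \<langle>x, h\<rangle> Q h\<close> is uncorrelated with \<open>\<langle>x, h\<rangle>\<close>; adding \<open>t Q h\<close> gives
  it a fresh component.\<close>

definition resample :: "'a \<Rightarrow> 'a \<times> real \<Rightarrow> 'a" where
  "resample h p = fst p + (snd p - inner (fst p) h) *\<^sub>R Q h"

lemma measurable_resample [measurable]: "resample h \<in> \<gamma> \<Otimes>\<^sub>M std_normal_distribution \<rightarrow>\<^sub>M borel"
  unfolding resample_def by measurable

lemma inner_resample: "inner (Q h) h = 1 \<Longrightarrow> inner (resample h p) h = snd p"
  by (simp add: resample_def inner_add_left)

text \<open>Given \<open>x\<close>, the characteristic function of the new component at \<open>k\<close> is \<open>exp(- a\<^sup>2 / 2)\<close> with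
  \<open>a = \<langle>Q h, k\<rangle>\<close>, and the remaining part has variance \<open>\<langle>Q k, k\<rangle> - a\<^sup>2\<close>; the two contributions add up to that
  of \<open>\<gamma>\<close>. This replaces any statement about joint normality or independence.\<close>

lemma distr_resample:
  assumes h: "inner (Q h) h = 1"
  shows "distr (\<gamma> \<Otimes>\<^sub>M std_normal_distribution) borel (resample h) = \<gamma>" (is "?D = _")
proof -
  interpret N: prob_space std_normal_distribution by (rule prob_std)
  interpret P: pair_prob_space \<gamma> std_normal_distribution
    by (intro pair_prob_space.intro pair_sigma_finite.intro sigma_finite_measure_axioms
        N.sigma_finite_measure_axioms prob_space_axioms N.prob_space_axioms)
  interpret D: prob_space ?D by (rule P.prob_space_distr) measurable
  show ?thesis
  proof (rule measure_eqI_cos)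
    fix k c
    define a where "a = inner (Q h) k"
    have "(\<integral>x. cos (inner x k + c) \<partial>?D) = (\<integral>p. cos (inner (resample h p) k + c) \<partial>(\<gamma> \<Otimes>\<^sub>M std_normal_distribution))"
      by (rule integral_distr) measurable
    also have "\<dots> = (\<integral>x. \<integral>t. cos (inner (resample h (x, t)) k + c) \<partial>std_normal_distribution \<partial>\<gamma>)"
      by (rule P.integral_fst'[symmetric]) (rule P.integrable_const_bound[where B = 1]; simp)
    also have "\<dots> = (\<integral>x. \<integral>t. cos (a * t + (inner x (k - a *\<^sub>R h) + c)) \<partial>std_normal_distribution \<partial>\<gamma>)"
      by (simp add: resample_def a_def inner_add_left inner_diff_right algebra_simps)
    also have "\<dots> = (\<integral>x. cos (inner x (k - a *\<^sub>R h) + c) * exp (- a\<^sup>2 / 2) \<partial>\<gamma>)"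
      by (simp add: std_cos)
    also have "\<dots> = cos c * exp (- inner (Q (k - a *\<^sub>R h)) (k - a *\<^sub>R h) / 2) * exp (- a\<^sup>2 / 2)"
      by (simp add: integral_cos)
    also have "inner (Q (k - a *\<^sub>R h)) (k - a *\<^sub>R h) = inner (Q k) k - a\<^sup>2"
    proof -
      have "inner (Q (k - a *\<^sub>R h)) (k - a *\<^sub>R h) = inner (Q (k - a *\<^sub>R h)) k - a * inner (Q (k - a *\<^sub>R h)) h"
        by (simp add: inner_diff_right)
      also have "\<dots> = inner (Q k) k - a * inner (Q k) h - a * (inner (Q h) k - a * inner (Q h) h)"
        unfolding Q_sym[of "k - a *\<^sub>R h"] by (simp add: inner_diff_right)
      also have "\<dots> = inner (Q k) k - a\<^sup>2"
        using h Q_sym[of k h] by (simp add: a_def power2_eq_square)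
      finally show ?thesis .
    qed
    finally show "(\<integral>x. cos (inner x k + c) \<partial>?D) = (\<integral>x. cos (inner x k + c) \<partial>\<gamma>)"
      unfolding integral_cos by (simp add: mult.assoc flip: exp_add) (simp add: field_simps)
  qed (simp_all add: sets_eq D.finite_measure_axioms finite_measure_axioms)
qed

text \<open>After resampling, \<open>\<langle>x, h\<rangle>\<close> becomes the variable \<open>t\<close>, and the formula is the one-dimensional one on
  each fibre. Only differentiability along \<open>Q h\<close> is assumed, so that products of smooth
  functions can be inserted directly.\<close>

theorem gaussian_ibp:
  fixes \<phi> d\<phi> :: "'a \<Rightarrow> real"
  assumes h: "inner (Q h) h = 1"
    and der: "\<And>x. ((\<lambda>t. \<phi> (x + t *\<^sub>R Q h)) has_real_derivative d\<phi> x) (at 0)"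
    and cont: "continuous_on UNIV \<phi>" "continuous_on UNIV d\<phi>"
    and bnd: "\<And>x. \<bar>\<phi> x\<bar> \<le> C" "\<And>x. \<bar>d\<phi> x\<bar> \<le> C"
  shows "(\<integral>x. \<phi> x * inner x h \<partial>\<gamma>) = (\<integral>x. d\<phi> x \<partial>\<gamma>)"
proof -
  interpret N: prob_space std_normal_distribution by (rule prob_std)
  interpret P: pair_prob_space \<gamma> std_normal_distribution
    by (intro pair_prob_space.intro pair_sigma_finite.intro sigma_finite_measure_axioms
        N.sigma_finite_measure_axioms prob_space_axioms N.prob_space_axioms)
  let ?P = "\<gamma> \<Otimes>\<^sub>M std_normal_distribution"
  have [measurable]: "\<phi> \<in> borel_measurable borel" "d\<phi> \<in> borel_measurable borel"
    using cont by (auto intro: borel_measurable_continuous_onI)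
  have i: "integrable \<gamma> (\<lambda>x. \<phi> x * inner x h)"
  proof (rule Bochner_Integration.integrable_bound)
    show "integrable \<gamma> (\<lambda>x. C * inner x h)" using integrable_inner by simp
    show "AE x in \<gamma>. norm (\<phi> x * inner x h) \<le> norm (C * inner x h)"
      using order_trans[OF bnd(1) abs_ge_self] by (simp add: abs_mult mult_right_mono)
  qed measurable
  have "integrable (distr ?P borel (resample h)) (\<lambda>x. \<phi> x * inner x h)"
    unfolding distr_resample[OF h] by (rule i)
  then have i': "integrable ?P (\<lambda>p. \<phi> (resample h p) * snd p)"
    by (subst (asm) integrable_distr_eq) (simp_all add: inner_resample[OF h])
  have i'': "integrable ?P (\<lambda>p. d\<phi> (resample h p))"
    by (rule P.integrable_const_bound[where B = C]) (use bnd in auto)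
  have fibre: "(\<integral>t. \<phi> (resample h (x, t)) * t \<partial>std_normal_distribution)
      = (\<integral>t. d\<phi> (resample h (x, t)) \<partial>std_normal_distribution)" for x
  proof (rule std_normal_ibp)
    fix t
    have "((\<lambda>s. \<phi> (resample h (x, t) + (s - t) *\<^sub>R Q h)) has_real_derivative d\<phi> (resample h (x, t)) * 1) (at t)"
      by (rule DERIV_chain2[where g = "\<lambda>s. s - t" and f = "\<lambda>s. \<phi> (resample h (x, t) + s *\<^sub>R Q h)"])
         (auto intro!: der derivative_eq_intros)
    moreover have "resample h (x, t) + (s - t) *\<^sub>R Q h = resample h (x, s)" for s
      by (simp add: resample_def algebra_simps)
    ultimately show "((\<lambda>s. \<phi> (resample h (x, s))) has_real_derivative d\<phi> (resample h (x, t))) (at t)"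
      by simp
  next
    show "continuous_on UNIV (\<lambda>t. d\<phi> (resample h (x, t)))"
      unfolding resample_def by (intro continuous_on_compose2[OF cont(2)] continuous_intros) auto
  qed (use bnd in auto)
  have "(\<integral>x. \<phi> x * inner x h \<partial>\<gamma>) = (\<integral>x. \<phi> x * inner x h \<partial>distr ?P borel (resample h))"
    by (simp add: distr_resample[OF h])
  also have "\<dots> = (\<integral>p. \<phi> (resample h p) * snd p \<partial>?P)"
    by (subst integral_distr) (simp_all add: inner_resample[OF h])
  also have "\<dots> = (\<integral>x. \<integral>t. \<phi> (resample h (x, t)) * t \<partial>std_normal_distribution \<partial>\<gamma>)"
    using P.integral_fst'[OF i'] by simp
  also have "\<dots> = (\<integral>x. \<integral>t. d\<phi> (resample h (x, t)) \<partial>std_normal_distribution \<partial>\<gamma>)"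
    by (simp add: fibre)
  also have "\<dots> = (\<integral>p. d\<phi> (resample h p) \<partial>?P)"
    using P.integral_fst'[OF i''] by simp
  also have "\<dots> = (\<integral>x. d\<phi> x \<partial>distr ?P borel (resample h))"
    by (subst integral_distr) simp_all
  finally show ?thesis by (simp add: distr_resample[OF h])
qed

end

section \<open>Gradients of smooth functions\<close>

text \<open>The representing vector minimises \<open>J x = \<parallel>x\<parallel>\<^sup>2 / 2 - f x\<close>. The parallelogram law makes minimising
  sequences Cauchy, and stationarity of the minimiser is the claim.\<close>

lemma Riesz_representation:
  fixes f :: "'a::{real_inner, complete_space} \<Rightarrow> real"
  assumes "bounded_linear f"
  shows "\<exists>g. \<forall>x. f x = inner g x"
proof -
  interpret f: bounded_linear f by fact
  define J where "J x = inner x x / 2 - f x" for x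
  have cont: "(\<lambda>n. J (X n)) \<longlonglongrightarrow> J x" if "X \<longlonglongrightarrow> x" for X x
    unfolding J_def by (intro tendsto_intros f.tendsto that) simp
  obtain K where K: "\<And>x. norm (f x) \<le> norm x * K" using f.bounded by blast
  have "- (K\<^sup>2 / 2) \<le> J x" for x
    using K[of x] zero_le_power2[of "norm x - K"]
    by (simp add: J_def power2_norm_eq_inner[symmetric] power2_diff abs_le_iff)
  then have bdd: "bdd_below (range J)" by (auto intro!: bdd_belowI[where m = "- (K\<^sup>2 / 2)"])
  define m where "m = Inf (range J)"
  have m: "m \<le> J x" for x unfolding m_def by (rule cInf_lower) (use bdd in auto)
  \<comment> \<open>The parallelogram law, with the value at the midpoint bounded below by the infimum.\<close>
  have par: "(norm (x - y))\<^sup>2 \<le> 4 * (J x - m) + 4 * (J y - m)" for x y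
  proof -
    have "(norm (x - y))\<^sup>2 = 4 * J x + 4 * J y - 8 * J ((1/2) *\<^sub>R (x + y))"
      by (simp add: J_def power2_norm_eq_inner f.add f.scaleR inner_add_left inner_add_right
          inner_diff_left inner_diff_right inner_commute algebra_simps)
    then show ?thesis using m[of "(1/2) *\<^sub>R (x + y)"] by simp
  qed
  have "\<exists>x. J x < m + e" if "e > 0" for e
    using cInf_lessD[of "range J" "m + e"] that unfolding m_def by auto
  then have "\<forall>n. \<exists>x. J x < m + inverse (real (Suc n))" by simp
  then obtain X where X: "\<And>n. J (X n) < m + inverse (real (Suc n))" by metis
  have limJ: "(\<lambda>n. J (X n)) \<longlonglongrightarrow> m"
  proof (rule tendsto_sandwich[OF _ _ tendsto_const])
    show "(\<lambda>n. m + inverse (real (Suc n))) \<longlonglongrightarrow> m"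
      using tendsto_add[OF tendsto_const LIMSEQ_inverse_real_of_nat, of m] by simp
    show "\<forall>\<^sub>F n in sequentially. J (X n) \<le> m + inverse (real (Suc n))"
      using X by (intro always_eventually allI less_imp_le)
  qed (use m in auto)
  have "Cauchy X"
  proof (rule metric_CauchyI)
    fix e :: real assume e: "0 < e"
    then have "\<forall>\<^sub>F n in sequentially. J (X n) < m + e\<^sup>2 / 8"
      by (intro order_tendstoD(2)[OF limJ]) simp
    then obtain M where M: "\<And>n. n \<ge> M \<Longrightarrow> J (X n) < m + e\<^sup>2 / 8"
      unfolding eventually_sequentially by blast
    have "dist (X i) (X j) < e" if "i \<ge> M" "j \<ge> M" for i j
    proof (rule power2_less_imp_less)
      show "(dist (X i) (X j))\<^sup>2 < e\<^sup>2"
        using par[of "X i" "X j"] M[OF that(1)] M[OF that(2)] by (simp add: dist_norm)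
    qed (use e in simp)
    then show "\<exists>M. \<forall>i\<ge>M. \<forall>j\<ge>M. dist (X i) (X j) < e" by blast
  qed
  then obtain g where g: "X \<longlonglongrightarrow> g" using Cauchy_convergent convergent_def by blast
  have Jg: "J g = m" using LIMSEQ_unique[OF cont[OF g] limJ] .
  have "f x = inner g x" for x
  proof (cases "x = 0")
    case False
    then have xx: "inner x x > 0" by simp
    define d where "d = inner g x - f x"
    have "0 \<le> t * d + t\<^sup>2 * inner x x / 2" for t
      using m[of "g + t *\<^sub>R x"] Jg
      by (simp add: J_def d_def f.add f.scaleR inner_add_left inner_add_right inner_commute
          power2_eq_square algebra_simps)
    from this[of "- d / inner x x"] have "d\<^sup>2 \<le> 0" using xx
      by (simp add: power2_eq_square field_simps)
    then show ?thesis by (simp add: d_def)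
  qed (simp add: f.zero)
  then show ?thesis by blast
qed

lemma Cb1_gradient:
  fixes \<phi> :: "'a::{real_inner, complete_space} \<Rightarrow> real"
  assumes "\<phi> \<in> Cb1"
  obtains g C where "\<And>x. (\<phi> has_derivative inner (g x)) (at x)" "continuous_on UNIV g"
    "\<And>x. \<bar>\<phi> x\<bar> \<le> C" "\<And>x. norm (g x) \<le> C"
proof -
  obtain D :: "'a \<Rightarrow> 'a \<Rightarrow>\<^sub>L real" where b: "bounded (range \<phi>)"
    and D: "\<And>x. (\<phi> has_derivative blinfun_apply (D x)) (at x)" "continuous_on UNIV D" "bounded (range D)"
    using assms unfolding Cb1_def by blast
  have "\<forall>x. \<exists>g. \<forall>y. blinfun_apply (D x) y = inner g y"
    using Riesz_representation blinfun.bounded_linear_right by blast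
  then obtain g where g: "\<And>x y. blinfun_apply (D x) y = inner (g x) y" by metis
  have dist_g: "norm (g x - g y) \<le> norm (D x - D y)" for x y
  proof (cases "g x = g y")
    case False
    have "norm (g x - g y) * norm (g x - g y) = blinfun_apply (D x - D y) (g x - g y)"
      by (simp add: blinfun.diff_left g power2_norm_eq_inner flip: inner_diff_left power2_eq_square)
    also have "\<dots> \<le> norm (D x - D y) * norm (g x - g y)"
      using norm_blinfun[of "D x - D y" "g x - g y"] by simp
    finally show ?thesis using False by simp
  qed simp
  have "norm (g x) \<le> norm (D x)" for x
  proof (cases "g x = 0")
    case False
    have "norm (g x) * norm (g x) = blinfun_apply (D x) (g x)"
      by (simp add: g power2_norm_eq_inner flip: power2_eq_square)
    also have "\<dots> \<le> norm (D x) * norm (g x)"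
      using norm_blinfun[of "D x" "g x"] by simp
    finally show ?thesis using False by simp
  qed simp
  moreover obtain C1 where "\<And>x. norm (D x) \<le> C1" using D(3) by (auto simp: bounded_iff)
  moreover obtain C2 where "\<And>x. \<bar>\<phi> x\<bar> \<le> C2" using b by (auto simp: bounded_iff)
  ultimately have "\<bar>\<phi> x\<bar> \<le> max C1 C2" "norm (g x) \<le> max C1 C2" for x
    by (meson max.coboundedI1 max.coboundedI2 order_trans)+
  moreover have "continuous_on UNIV g"
    using D(2) unfolding continuous_on_iff dist_norm by (meson dist_g order_le_less_trans)
  moreover have "(\<phi> has_derivative inner (g x)) (at x)" for x using D(1)[of x] by (simp add: g[abs_def])
  ultimately show ?thesis using that by blast
qed

lemma has_derivative_line:
  fixes \<phi> :: "'a::real_inner \<Rightarrow> real"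
  assumes "(\<phi> has_derivative inner g) (at x)"
  shows "((\<lambda>t. \<phi> (x + t *\<^sub>R v)) has_real_derivative inner g v) (at 0)"
proof -
  have "((\<lambda>t. x + t *\<^sub>R v) has_derivative (\<lambda>t. t *\<^sub>R v)) (at 0)"
    by (auto intro!: derivative_eq_intros)
  moreover have "(\<phi> has_derivative inner g) (at (x + 0 *\<^sub>R v))" using assms by simp
  ultimately have "((\<lambda>t. \<phi> (x + t *\<^sub>R v)) has_derivative (\<lambda>t. inner g (t *\<^sub>R v))) (at 0)"
    by (rule has_derivative_compose)
  then show ?thesis by (simp add: has_field_derivative_def mult_commute_abs)
qed

section \<open>Weak convergence and uniqueness\<close>

lemma integrable_mult_L2:
  fixes a w :: "'a \<Rightarrow> real"
  assumes [measurable]: "a \<in> borel_measurable M" "w \<in> borel_measurable M"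
    and "integrable M (\<lambda>x. (a x)\<^sup>2)" "integrable M (\<lambda>x. (w x)\<^sup>2)"
  shows "integrable M (\<lambda>x. a x * w x)"
proof (rule Bochner_Integration.integrable_bound)
  show "integrable M (\<lambda>x. (a x)\<^sup>2 + (w x)\<^sup>2)" using assms by simp
  have "\<bar>a x * w x\<bar> \<le> (a x)\<^sup>2 + (w x)\<^sup>2" for x
  proof -
    have "2 * (\<bar>a x\<bar> * \<bar>w x\<bar>) \<le> (a x)\<^sup>2 + (w x)\<^sup>2"
      using zero_le_power2[of "\<bar>a x\<bar> - \<bar>w x\<bar>"] by (simp add: power2_diff)
    moreover have "0 \<le> \<bar>a x\<bar> * \<bar>w x\<bar>" by simp
    ultimately show ?thesis unfolding abs_mult by linarith
  qed
  then show "AE x in M. norm (a x * w x) \<le> norm ((a x)\<^sup>2 + (w x)\<^sup>2)" by simp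
qed measurable

text \<open>Strong convergence in \<open>L\<^sup>2\<close> implies weak convergence; stated with extended nonnegative
  integrals because the closed graphs are defined through them.\<close>

lemma L2_tendsto_integral:
  fixes a :: "nat \<Rightarrow> 'a \<Rightarrow> real"
  assumes [measurable]: "\<And>n. a n \<in> borel_measurable M" "b \<in> borel_measurable M" "w \<in> borel_measurable M"
    and a: "\<And>n. integrable M (\<lambda>x. (a n x)\<^sup>2)" and b: "integrable M (\<lambda>x. (b x)\<^sup>2)"
    and w: "integrable M (\<lambda>x. (w x)\<^sup>2)"
    and lim: "(\<lambda>n. \<integral>\<^sup>+x. ennreal ((a n x - b x)\<^sup>2) \<partial>M) \<longlonglongrightarrow> 0"
  shows "(\<lambda>n. \<integral>x. a n x * w x \<partial>M) \<longlonglongrightarrow> (\<integral>x. b x * w x \<partial>M)"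
proof -
  define d where "d n = (\<integral>x. a n x * w x \<partial>M) - (\<integral>x. b x * w x \<partial>M)" for n
  define W where "W = (\<integral>\<^sup>+x. ennreal ((w x)\<^sup>2) \<partial>M)"
  have W: "W < top" unfolding W_def using integrableD(2)[OF w] by (simp add: less_top)
  have le: "ennreal ((d n)\<^sup>2) \<le> W * (\<integral>\<^sup>+x. ennreal ((a n x - b x)\<^sup>2) \<partial>M)" for n
  proof -
    have i: "integrable M (\<lambda>x. a n x * w x)" "integrable M (\<lambda>x. b x * w x)"
      using a b w by (auto intro!: integrable_mult_L2)
    have "d n = (\<integral>x. (a n x - b x) * w x \<partial>M)" unfolding d_def using i by (simp add: left_diff_distrib)
    moreover have "integrable M (\<lambda>x. (a n x - b x) * w x)" using i by (simp add: left_diff_distrib)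
    ultimately have "ennreal \<bar>d n\<bar> \<le> (\<integral>\<^sup>+x. ennreal \<bar>(a n x - b x) * w x\<bar> \<partial>M)"
      using integral_norm_bound_ennreal by fastforce
    also have "\<dots> = (\<integral>\<^sup>+x. ennreal \<bar>a n x - b x\<bar> * ennreal \<bar>w x\<bar> \<partial>M)"
      by (simp add: abs_mult ennreal_mult)
    finally have "(ennreal \<bar>d n\<bar>)\<^sup>2 \<le> (\<integral>\<^sup>+x. ennreal \<bar>a n x - b x\<bar> * ennreal \<bar>w x\<bar> \<partial>M)\<^sup>2"
      by (rule power_mono) simp
    also have "\<dots> \<le> (\<integral>\<^sup>+x. (ennreal \<bar>a n x - b x\<bar>)\<^sup>2 \<partial>M) * (\<integral>\<^sup>+x. (ennreal \<bar>w x\<bar>)\<^sup>2 \<partial>M)"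
      by (rule Cauchy_Schwarz_nn_integral) measurable
    finally show ?thesis by (simp add: ennreal_power W_def mult.commute)
  qed
  have "(\<lambda>n. W * (\<integral>\<^sup>+x. ennreal ((a n x - b x)\<^sup>2) \<partial>M)) \<longlonglongrightarrow> W * 0"
    by (rule ennreal_tendsto_cmult[OF W lim])
  then have bound: "(\<lambda>n. W * (\<integral>\<^sup>+x. ennreal ((a n x - b x)\<^sup>2) \<partial>M)) \<longlonglongrightarrow> ennreal 0" by simp
  have "(\<lambda>n. ennreal ((d n)\<^sup>2)) \<longlonglongrightarrow> ennreal 0"
    by (rule tendsto_sandwich[OF _ _ tendsto_const bound]) (simp, intro always_eventually allI le)
  then have "(\<lambda>n. (d n)\<^sup>2) \<longlonglongrightarrow> 0" by (subst (asm) tendsto_ennreal_iff) auto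
  then have "(\<lambda>n. sqrt ((d n)\<^sup>2)) \<longlonglongrightarrow> sqrt 0" by (rule tendsto_real_sqrt)
  then have "d \<longlonglongrightarrow> 0" by (simp add: tendsto_rabs_zero_iff)
  then show ?thesis unfolding d_def by (simp add: LIM_zero_iff)
qed

text \<open>The positive and negative parts of \<open>g\<close> are densities of two finite measures with the same
  characteristic function.\<close>

lemma AE_eq_0_if_cos:
  fixes g :: "'a::{real_inner, polish_space} \<Rightarrow> real"
  assumes M: "sets M = sets borel" "finite_measure M" and g: "integrable M g"
    and orth: "\<And>k c. (\<integral>x. g x * cos (inner x k + c) \<partial>M) = 0"
  shows "AE x in M. g x = 0"
proof -
  interpret finite_measure M by fact
  note [measurable_cong] = M(1)
  have [measurable]: "g \<in> borel_measurable M" using g by simp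
  define P N where "P = density M (\<lambda>x. ennreal (max 0 (g x)))" "N = density M (\<lambda>x. ennreal (max 0 (- g x)))"
  have pos: "integrable M (\<lambda>x. max 0 (g x))" "integrable M (\<lambda>x. max 0 (- g x))"
    using g by auto
  have fin: "finite_measure (density M (\<lambda>x. ennreal (f x)))" if "integrable M f" "\<And>x. 0 \<le> f x" for f
  proof (rule finite_measureI)
    have [measurable]: "f \<in> borel_measurable M" using that by simp
    have "emeasure (density M (\<lambda>x. ennreal (f x))) (space M) = (\<integral>\<^sup>+x. ennreal (f x) \<partial>M)"
      by (subst emeasure_density) (auto intro!: nn_integral_cong)
    then show "emeasure (density M (\<lambda>x. ennreal (f x))) (space (density M (\<lambda>x. ennreal (f x)))) \<noteq> \<infinity>"
      using integrableD(2)[OF that(1)] that(2) by simp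
  qed
  have "P = N"
  proof (rule measure_eqI_cos)
    show "sets P = sets borel" "sets N = sets borel" by (simp_all add: P_N_def M)
    show "finite_measure P" "finite_measure N"
      unfolding P_N_def by (intro fin pos; simp)+
    fix k c
    have i: "integrable M (\<lambda>x. f x * cos (inner x k + c))" if "integrable M f" for f
    proof (rule Bochner_Integration.integrable_bound[OF that])
      show "AE x in M. norm (f x * cos (inner x k + c)) \<le> norm (f x)"
        by (simp add: abs_mult mult_left_le)
    qed (use that in measurable)
    have "(\<integral>x. max 0 (g x) * cos (inner x k + c) \<partial>M) - (\<integral>x. max 0 (- g x) * cos (inner x k + c) \<partial>M)
        = (\<integral>x. max 0 (g x) * cos (inner x k + c) - max 0 (- g x) * cos (inner x k + c) \<partial>M)"
      by (rule Bochner_Integration.integral_diff[symmetric]) (intro i pos)+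
    also have "\<dots> = (\<integral>x. g x * cos (inner x k + c) \<partial>M)"
      by (rule Bochner_Integration.integral_cong) (auto simp: max_def)
    also have "\<dots> = 0" by (rule orth)
    finally show "(\<integral>x. cos (inner x k + c) \<partial>P) = (\<integral>x. cos (inner x k + c) \<partial>N)"
      unfolding P_N_def by (subst (1 2) integral_density) auto
  qed
  then have "AE x in M. ennreal (max 0 (g x)) = ennreal (max 0 (- g x))"
    unfolding P_N_def by (intro density_unique) measurable
  then show ?thesis by (rule AE_mp) (auto simp: max_def split: if_splits)
qed

section \<open>The Cameron--Martin isometry and closability\<close>

locale nondegenerate_gaussian = centered_gaussian +
  assumes bounded_linear_Q: "bounded_linear Q" and self_adjoint_Q: "self_adjoint Q"
    and nonneg_Q: "nonneg_op Q" and ker_Q: "{x. Q x = 0} = {0}"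
begin

abbreviation R :: "'a \<Rightarrow> 'a" where "R \<equiv> op_sqrt Q"

sublocale R: bounded_linear R
  by (rule op_sqrt_props(1)) (fact bounded_linear_Q self_adjoint_Q nonneg_Q)+

lemma R_self: "inner (R x) y = inner x (R y)"
  using op_sqrt_props(2)[OF bounded_linear_Q self_adjoint_Q nonneg_Q] by (simp add: self_adjoint_def)

lemma R_R: "R (R x) = Q x"
  using op_sqrt_props(4)[OF bounded_linear_Q self_adjoint_Q nonneg_Q] by (simp add: fun_eq_iff)

lemma R_eq_0: "R x = 0 \<longleftrightarrow> x = 0"
proof
  assume "R x = 0"
  then have "Q x = 0" using R_R[of x] by (simp add: R.zero)
  then show "x = 0" using ker_Q by blast
qed (simp add: R.zero)

lemma inj_R: "inj R"
  by (rule injI) (metis R.diff R_eq_0 eq_iff_diff_eq_0)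

lemma inv_R [simp]: "inv R (R x) = x" by (rule inv_f_f[OF inj_R])

lemma cm_norm_eq: "cm_norm Q h = norm (inv R h)"
  by (simp add: cm_norm_def cm_inner_def norm_eq_sqrt_inner)

lemma cm_inner_R [simp]: "cm_inner Q (R u) (R v) = inner u v" by (simp add: cm_inner_def)

lemma cm_norm_R [simp]: "cm_norm Q (R u) = norm u" by (simp add: cm_norm_eq)

text \<open>Symmetry of a metric on a carrier is also demanded off the carrier. It holds there
  because the inverse of \<open>R\<close> has one and the same default value outside the range, and \<open>x - y\<close> is in the
  range exactly when \<open>y - x\<close> is.\<close>

lemma Metric_space_cm: "Metric_space (cm_space Q) (\<lambda>h k. cm_norm Q (h - k))"
proof
  show "0 \<le> cm_norm Q (x - y)" for x y by (simp add: cm_norm_eq)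
  show "cm_norm Q (x - y) = cm_norm Q (y - x)" for x y
  proof (cases "x - y \<in> range R")
    case True
    then obtain u where "x - y = R u" by auto
    moreover then have "y - x = R (- u)" by (metis R.neg minus_diff_eq)
    ultimately show ?thesis by (simp del: minus_diff_eq)
  next
    case False
    moreover have "y - x \<notin> range R"
    proof
      assume "y - x \<in> range R"
      then obtain u where "y - x = R u" by auto
      then have "x - y = R (- u)" using minus_diff_eq[of y x] by (simp add: R.neg)
      then show False using False by simp
    qed
    moreover have "inv R h = (SOME v. False)" if "h \<notin> range R" for h
    proof -
      have "(\<lambda>v. v \<in> UNIV \<and> R v = h) = (\<lambda>_. False)" using that by auto
      then show ?thesis unfolding inv_into_def by (rule arg_cong)
    qed
    ultimately show ?thesis unfolding cm_norm_eq by metis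
  qed
  show "cm_norm Q (x - y) = 0 \<longleftrightarrow> x = y" if xy: "x \<in> cm_space Q" "y \<in> cm_space Q" for x y
  proof -
    obtain u v where uv: "x = R u" "y = R v" using xy by (auto simp: cm_space_def)
    then have "cm_norm Q (x - y) = norm (u - v)" by (simp flip: R.diff)
    then show ?thesis using uv inj_eq[OF inj_R] by simp
  qed
  show "cm_norm Q (x - z) \<le> cm_norm Q (x - y) + cm_norm Q (y - z)"
    if xyz: "x \<in> cm_space Q" "y \<in> cm_space Q" "z \<in> cm_space Q" for x y z
  proof -
    obtain u v w where "x = R u" "y = R v" "z = R w" using xyz by (auto simp: cm_space_def)
    then show ?thesis using dist_triangle[of u w v] by (simp add: dist_norm flip: R.diff)
  qed
qed

lemma openin_cm_topology:
  "openin (cm_topology Q) U \<longleftrightarrow> U \<subseteq> range R \<and> open (R -` U)"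
proof -
  interpret Metric_space "cm_space Q" "\<lambda>h k. cm_norm Q (h - k)" by (rule Metric_space_cm)
  have "cm_norm Q (R v - R w) = dist v w" for v w by (simp add: dist_norm flip: R.diff)
  then have "mball (R v) r = R ` ball v r" for v r unfolding mball_def by (auto simp: cm_space_def)
  then have b: "mball (R v) r \<subseteq> U \<longleftrightarrow> ball v r \<subseteq> R -` U" for v r by auto
  show ?thesis
    unfolding cm_topology_def openin_mtopology open_contains_ball b[symmetric]
    by (rule conj_cong) (simp add: cm_space_def, blast)
qed

lemma space_cm_borel: "space (cm_borel Q) = range R"
  and sets_cm_borel: "openin (cm_topology Q) U \<Longrightarrow> U \<in> sets (cm_borel Q)"
proof -
  have *: "{U. openin (cm_topology Q) U} \<subseteq> Pow (cm_space Q)"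
    by (auto simp: openin_cm_topology cm_space_def)
  show "space (cm_borel Q) = range R"
    unfolding cm_borel_def using * by (simp add: space_measure_of cm_space_def)
  show "U \<in> sets (cm_borel Q)" if "openin (cm_topology Q) U"
    unfolding cm_borel_def using * that by (simp add: in_measure_of)
qed

lemma measurable_R: "R \<in> borel \<rightarrow>\<^sub>M cm_borel Q"
  unfolding cm_borel_def
  by (rule measurable_measure_of) (auto simp: openin_cm_topology cm_space_def)

lemma measurable_inv_R: "inv R \<in> cm_borel Q \<rightarrow>\<^sub>M borel"
proof (rule borel_measurableI)
  fix S :: "'a set" assume "open S"
  have "inv R -` S \<inter> space (cm_borel Q) = R ` S" by (auto simp: space_cm_borel)
  moreover have "R -` (R ` S) = S" using inj_R by (simp add: inj_vimage_image_eq)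
  ultimately show "inv R -` S \<inter> space (cm_borel Q) \<in> sets (cm_borel Q)"
    using \<open>open S\<close> by (auto intro!: sets_cm_borel simp: openin_cm_topology)
qed

text \<open>\<open>R\<close> is an isometry onto the Cameron--Martin space with its own topology, so it and its
  inverse are continuous, hence measurable for the corresponding Borel structures.\<close>

lemma L2_cm_eq: "L2_cm \<gamma> Q = (\<lambda>G x. R (G x)) ` L2_fun \<gamma>"
proof (intro equalityI subsetI)
  fix G assume G: "G \<in> L2_cm \<gamma> Q"
  then have m: "G \<in> \<gamma> \<rightarrow>\<^sub>M cm_borel Q" by (simp add: L2_cm_def)
  have "G x \<in> range R" for x using measurable_space[OF m, of x] by (simp add: space_cm_borel)
  then have "G = (\<lambda>x. R (inv R (G x)))" by (simp add: f_inv_into_f fun_eq_iff)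
  moreover have "(\<lambda>x. inv R (G x)) \<in> L2_fun \<gamma>"
    using G measurable_compose[OF m measurable_inv_R] by (simp add: L2_cm_def L2_fun_def cm_norm_eq)
  ultimately show "G \<in> (\<lambda>G x. R (G x)) ` L2_fun \<gamma>" by (rule image_eqI)
next
  fix G assume "G \<in> (\<lambda>G x. R (G x)) ` L2_fun \<gamma>"
  then obtain G' where "G = (\<lambda>x. R (G' x))" "G' \<in> L2_fun \<gamma>" by blast
  then show "G \<in> L2_cm \<gamma> Q"
    by (auto simp: L2_cm_def L2_fun_def intro: measurable_compose[OF _ measurable_R])
qed

text \<open>The derivative along \<open>R v\<close> is \<open>\<langle>g, R v\<rangle>\<close>, and \<open>R\<close> moves to the other side.\<close>

lemma cdp_gradient_eq:
  assumes "(\<phi> has_derivative inner g) (at x)"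
  shows "cdp_gradient Q \<phi> x = R g"
  unfolding cdp_gradient_def
proof (rule the_equality)
  have lim: "((\<lambda>s. (\<phi> (x + s *\<^sub>R R v) - \<phi> x) / s) \<longlongrightarrow> inner (R g) v) (at 0)" for v
    using has_derivative_line[OF assms, of "R v"] by (simp add: has_field_derivative_iff R_self)
  show "is_cdp_gradient Q \<phi> x (R g)"
    unfolding is_cdp_gradient_def by (intro allI tendsto_rabs_zero LIM_zero lim)
  fix g' assume g': "is_cdp_gradient Q \<phi> x g'"
  have "inner g' v = inner (R g) v" for v
  proof (rule tendsto_unique[OF _ _ lim])
    have "((\<lambda>s. (\<phi> (x + s *\<^sub>R R v) - \<phi> x) / s - inner g' v) \<longlongrightarrow> 0) (at 0)"
      using g' unfolding is_cdp_gradient_def tendsto_rabs_zero_iff by blast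
    then show "((\<lambda>s. (\<phi> (x + s *\<^sub>R R v) - \<phi> x) / s) \<longlongrightarrow> inner g' v) (at 0)"
      by (simp add: LIM_zero_iff)
  qed simp
  then show "g' = R g" by (metis inner_commute vector_eq_rdot inner_eq_zero_iff inner_diff_left eq_iff_diff_eq_0)
qed

text \<open>The Cameron--Martin norm dominates the norm of \<open>H\<close> up to a constant, so the Frechet
  expansion in \<open>H\<close> is one in the finer norm as well, with \<open>\<langle>R (R g), R v\<rangle> = \<langle>g, R v\<rangle>\<close> in the
  Cameron--Martin product. For uniqueness, two candidates are tested along their own difference.\<close>

lemma gross_gradient_eq:
  assumes "(\<phi> has_derivative inner g) (at x)"
  shows "gross_gradient Q \<phi> x = R (R g)"
  unfolding gross_gradient_def
proof (rule the_equality)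
  obtain K where K: "K > 0" "\<And>v. norm (R v) \<le> norm v * K" using R.pos_bounded by blast
  show ex: "is_gross_gradient Q \<phi> x (R (R g))"
    unfolding is_gross_gradient_def
  proof (intro conjI allI impI)
    show "R (R g) \<in> cm_space Q" by (simp add: cm_space_def)
    fix \<epsilon> :: real assume \<epsilon>: "0 < \<epsilon>"
    then have "0 < \<epsilon> / (2 * K)" using K by simp
    then obtain d where d: "d > 0" "\<And>y. norm (y - x) < d \<Longrightarrow>
        norm (\<phi> y - \<phi> x - inner g (y - x)) \<le> \<epsilon> / (2 * K) * norm (y - x)"
      using assms unfolding has_derivative_at_alt by metis
    show "\<exists>\<delta>>0. \<forall>h\<in>cm_space Q. 0 < cm_norm Q h \<and> cm_norm Q h < \<delta> \<longrightarrow>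
        \<bar>\<phi> (x + h) - \<phi> x - cm_inner Q (R (R g)) h\<bar> / cm_norm Q h < \<epsilon>"
    proof (intro exI[of _ "d / K"] conjI ballI impI)
      show "0 < d / K" using d K by simp
      fix h assume "h \<in> cm_space Q" and h: "0 < cm_norm Q h \<and> cm_norm Q h < d / K"
      then obtain v where v: "h = R v" by (auto simp: cm_space_def)
      have n: "0 < norm v" "norm v < d / K" using h v by auto
      then have "norm (R v) < d" using K(2)[of v] K(1) by (simp add: pos_less_divide_eq)
      then have "\<bar>\<phi> (x + R v) - \<phi> x - inner g (R v)\<bar> \<le> \<epsilon> / (2 * K) * norm (R v)"
        using d(2)[of "x + R v"] by simp
      also have "\<dots> \<le> \<epsilon> / (2 * K) * (norm v * K)"
        using K \<epsilon> by (intro mult_left_mono) auto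
      also have "\<dots> = \<epsilon> / 2 * norm v" using K by simp
      also have "\<dots> < \<epsilon> * norm v" using \<epsilon> n by simp
      finally show "\<bar>\<phi> (x + h) - \<phi> x - cm_inner Q (R (R g)) h\<bar> / cm_norm Q h < \<epsilon>"
        using n v by (simp add: R_self pos_divide_less_eq)
    qed
  qed
  fix g' assume g': "is_gross_gradient Q \<phi> x g'"
  then obtain u where u: "g' = R u" by (auto simp: is_gross_gradient_def cm_space_def)
  define d where "d = u - R g"
  have "d = 0"
  proof (rule ccontr)
    assume "d \<noteq> 0"
    then have n: "norm d > 0" by simp
    obtain \<delta>1 where 1: "\<delta>1 > 0" "\<And>h. h \<in> cm_space Q \<Longrightarrow> 0 < cm_norm Q h \<Longrightarrow> cm_norm Q h < \<delta>1 \<Longrightarrow>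
        \<bar>\<phi> (x + h) - \<phi> x - cm_inner Q (R (R g)) h\<bar> / cm_norm Q h < norm d / 2"
      using ex n unfolding is_gross_gradient_def by (meson half_gt_zero)
    obtain \<delta>2 where 2: "\<delta>2 > 0" "\<And>h. h \<in> cm_space Q \<Longrightarrow> 0 < cm_norm Q h \<Longrightarrow> cm_norm Q h < \<delta>2 \<Longrightarrow>
        \<bar>\<phi> (x + h) - \<phi> x - cm_inner Q g' h\<bar> / cm_norm Q h < norm d / 2"
      using g' n unfolding is_gross_gradient_def by (meson half_gt_zero)
    define t where "t = min \<delta>1 \<delta>2 / (2 * norm d)"
    have t: "t > 0" using 1 2 n by (simp add: t_def)
    have "t * norm d = min \<delta>1 \<delta>2 / 2" using n by (simp add: t_def)
    then have small: "t * norm d < \<delta>1" "t * norm d < \<delta>2" using 1(1) 2(1) by auto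
    define h where "h = R (t *\<^sub>R d)"
    have h: "h \<in> cm_space Q" "cm_norm Q h = t * norm d" using t by (simp_all add: h_def cm_space_def)
    have "\<bar>\<phi> (x + h) - \<phi> x - inner (R g) (t *\<^sub>R d)\<bar> < norm d / 2 * (t * norm d)"
      using 1(2)[of h] h small t n by (simp add: h_def pos_divide_less_eq)
    moreover have "\<bar>\<phi> (x + h) - \<phi> x - inner u (t *\<^sub>R d)\<bar> < norm d / 2 * (t * norm d)"
      using 2(2)[of h] h small t n u by (simp add: h_def pos_divide_less_eq)
    ultimately have "\<bar>inner u (t *\<^sub>R d) - inner (R g) (t *\<^sub>R d)\<bar> < norm d * (t * norm d)" by argo
    moreover have "inner u (t *\<^sub>R d) - inner (R g) (t *\<^sub>R d) = norm d * (t * norm d)"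
      unfolding inner_diff_left[symmetric] d_def[symmetric]
      by (simp add: power2_norm_eq_inner[symmetric] power2_eq_square)
    ultimately show False using abs_ge_self[of "norm d * (t * norm d)"] by simp
  qed
  then show "g' = R (R g)" using u d_def by simp
qed

text \<open>For smooth functions the Gross gradient is \<open>R\<close> applied to the other gradient, and \<open>R\<close>
  preserves the distances that define the two closures.\<close>

lemma gross_graph_iff:
  "(f, G) \<in> gross_graph \<gamma> Q \<longleftrightarrow> (\<exists>G'. G = (\<lambda>x. R (G' x)) \<and> (f, G') \<in> cdp_graph \<gamma> Q)"
proof -
  have grad: "gross_gradient Q \<phi> x = R (cdp_gradient Q \<phi> x)" if \<phi>: "\<phi> \<in> Cb1" for \<phi> x
    using Cb1_gradient[OF \<phi>] cdp_gradient_eq gross_gradient_eq by metis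
  have "cm_norm Q (gross_gradient Q \<phi> x - R (G' x)) = norm (cdp_gradient Q \<phi> x - G' x)"
    if "\<phi> \<in> Cb1" for \<phi> x and G' :: "'a \<Rightarrow> 'a"
    using grad[OF that] by (simp flip: R.diff)
  then have lim: "(\<lambda>n. \<integral>\<^sup>+x. ennreal ((cm_norm Q (gross_gradient Q (\<phi> n) x - R (G' x)))\<^sup>2) \<partial>\<gamma>)
      = (\<lambda>n. \<integral>\<^sup>+x. ennreal ((norm (cdp_gradient Q (\<phi> n) x - G' x))\<^sup>2) \<partial>\<gamma>)"
    if "\<forall>n. \<phi> n \<in> Cb1" for \<phi> and G' :: "'a \<Rightarrow> 'a"
    using that by simp
  show ?thesis
  proof
    assume "(f, G) \<in> gross_graph \<gamma> Q"
    then obtain \<phi> where f: "f \<in> L2_fun \<gamma>" "G \<in> L2_cm \<gamma> Q" and \<phi>: "\<forall>n. \<phi> n \<in> Cb1"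
      and l: "(\<lambda>n. \<integral>\<^sup>+x. ennreal ((\<phi> n x - f x)\<^sup>2) \<partial>\<gamma>) \<longlonglongrightarrow> 0"
        "(\<lambda>n. \<integral>\<^sup>+x. ennreal ((cm_norm Q (gross_gradient Q (\<phi> n) x - G x))\<^sup>2) \<partial>\<gamma>) \<longlonglongrightarrow> 0"
      unfolding gross_graph_def by blast
    from f(2) obtain G' where G': "G = (\<lambda>x. R (G' x))" "G' \<in> L2_fun \<gamma>" unfolding L2_cm_eq by blast
    have "(f, G') \<in> cdp_graph \<gamma> Q"
      unfolding cdp_graph_def mem_Collect_eq prod.case
      by (intro conjI exI[of _ \<phi>] f(1) G'(2) \<phi> l(1) l(2)[unfolded G'(1) lim[OF \<phi>]])
    with G'(1) show "\<exists>G'. G = (\<lambda>x. R (G' x)) \<and> (f, G') \<in> cdp_graph \<gamma> Q" by blast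
  next
    assume "\<exists>G'. G = (\<lambda>x. R (G' x)) \<and> (f, G') \<in> cdp_graph \<gamma> Q"
    then obtain G' \<phi> where G: "G = (\<lambda>x. R (G' x))" and f: "f \<in> L2_fun \<gamma>" "G' \<in> L2_fun \<gamma>"
      and \<phi>: "\<forall>n. \<phi> n \<in> Cb1"
      and l: "(\<lambda>n. \<integral>\<^sup>+x. ennreal ((\<phi> n x - f x)\<^sup>2) \<partial>\<gamma>) \<longlonglongrightarrow> 0"
        "(\<lambda>n. \<integral>\<^sup>+x. ennreal ((norm (cdp_gradient Q (\<phi> n) x - G' x))\<^sup>2) \<partial>\<gamma>) \<longlonglongrightarrow> 0"
      unfolding cdp_graph_def by blast
    have "(\<lambda>x. R (G' x)) \<in> L2_cm \<gamma> Q" unfolding L2_cm_eq using f(2) by blast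
    then show "(f, G) \<in> gross_graph \<gamma> Q"
      unfolding gross_graph_def mem_Collect_eq prod.case G
      by (intro conjI exI[of _ \<phi>] f(1) \<phi> l(1) l(2)[folded lim[OF \<phi>]])
  qed
qed

text \<open>Integration by parts for \<open>\<phi>\<^sub>n \<psi>\<close> with \<open>\<psi> x = cos (\<langle>x, k\<rangle> + c)\<close>, where \<open>\<phi>\<^sub>n\<close> approximates \<open>f\<close>,
  moves the derivative off \<open>\<phi>\<^sub>n\<close>; all terms then pass to the \<open>L\<^sup>2\<close> limit.\<close>

lemma cdp_graph_ibp:
  assumes fG: "(f, G) \<in> cdp_graph \<gamma> Q" and h: "inner (Q h) h = 1"
  shows "(\<integral>x. inner (G x) (R h) * cos (inner x k + c) \<partial>\<gamma>)
    = (\<integral>x. f x * (cos (inner x k + c) * inner x h + sin (inner x k + c) * inner (Q h) k) \<partial>\<gamma>)"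
proof -
  obtain \<phi> where f: "f \<in> L2_fun \<gamma>" and G: "G \<in> L2_fun \<gamma>" and \<phi>: "\<And>n. \<phi> n \<in> Cb1"
    and lim: "(\<lambda>n. \<integral>\<^sup>+x. ennreal ((\<phi> n x - f x)\<^sup>2) \<partial>\<gamma>) \<longlonglongrightarrow> 0"
      "(\<lambda>n. \<integral>\<^sup>+x. ennreal ((norm (cdp_gradient Q (\<phi> n) x - G x))\<^sup>2) \<partial>\<gamma>) \<longlonglongrightarrow> 0"
    using fG unfolding cdp_graph_def by auto
  have [measurable]: "f \<in> borel_measurable \<gamma>" "G \<in> borel_measurable \<gamma>"
    using f G by (simp_all add: L2_fun_def)
  have "\<forall>n. \<exists>g C. (\<forall>x. (\<phi> n has_derivative inner (g x)) (at x)) \<and> continuous_on UNIV g \<and>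
      (\<forall>x. \<bar>\<phi> n x\<bar> \<le> C) \<and> (\<forall>x. norm (g x) \<le> C)"
    using Cb1_gradient[OF \<phi>] by metis
  then obtain g C where g: "\<And>n x. (\<phi> n has_derivative inner (g n x)) (at x)"
    "\<And>n. continuous_on UNIV (g n)" "\<And>n x. \<bar>\<phi> n x\<bar> \<le> C n" "\<And>n x. norm (g n x) \<le> C n"
    by metis
  have grad: "cdp_gradient Q (\<phi> n) x = R (g n x)" for n x by (rule cdp_gradient_eq) (rule g)
  have cont: "continuous_on UNIV (\<phi> n)" for n
    using g(1) by (intro continuous_at_imp_continuous_on) (auto intro: has_derivative_continuous)
  have contR: "continuous_on UNIV (\<lambda>x. R (g n x))" for n
    by (rule R.continuous_on) (rule g)
  have [measurable]: "\<phi> n \<in> borel_measurable borel" "(\<lambda>x. R (g n x)) \<in> borel_measurable borel" for n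
    using cont contR by (auto intro: borel_measurable_continuous_onI)
  obtain K where K: "K > 0" "\<And>v. norm (R v) \<le> norm v * K" using R.pos_bounded by blast
  define \<psi> where "\<psi> x = cos (inner x k + c)" for x
  define d\<psi> where "d\<psi> x = - sin (inner x k + c) * inner (Q h) k" for x
  define w where "w x = \<psi> x * inner x h - d\<psi> x" for x
  have [measurable]: "\<psi> \<in> borel_measurable borel" "d\<psi> \<in> borel_measurable borel" "w \<in> borel_measurable borel"
    unfolding \<psi>_def d\<psi>_def w_def by measurable
  have \<psi>1: "\<bar>\<psi> x\<bar> \<le> 1" for x by (simp add: \<psi>_def)
  have d\<psi>1: "\<bar>d\<psi> x\<bar> \<le> \<bar>inner (Q h) k\<bar>" for x by (simp add: d\<psi>_def abs_mult mult_left_le_one_le)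
  have identity: "(\<integral>x. inner (R (g n x)) (R h) * \<psi> x \<partial>\<gamma>) = (\<integral>x. \<phi> n x * w x \<partial>\<gamma>)" for n
  proof -
    define q where "q x = inner (g n x) (Q h)" for x
    have q: "inner (R (g n x)) (R h) = q x" for x by (simp add: q_def R_self R_R)
    have [measurable]: "q \<in> borel_measurable borel" unfolding q[symmetric] by measurable
    have q1: "\<bar>q x\<bar> \<le> C n * norm (Q h)" for x
      using Cauchy_Schwarz_ineq2[of "g n x" "Q h"] mult_right_mono[OF g(4)[of n x] norm_ge_zero[of "Q h"]]
      by (simp add: q_def)
    have C0: "0 \<le> C n" using g(4)[of n 0] norm_ge_zero order_trans by blast
    \<comment> \<open>One constant has to bound both the product and its derivative along \<open>Q h\<close>.\<close>
    have "(\<integral>x. (\<phi> n x * \<psi> x) * inner x h \<partial>\<gamma>) = (\<integral>x. q x * \<psi> x + \<phi> n x * d\<psi> x \<partial>\<gamma>)"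
    proof (rule gaussian_ibp[OF h])
      fix x
      have l: "((\<lambda>t. \<psi> (x + t *\<^sub>R Q h)) has_real_derivative d\<psi> x) (at 0)"
        unfolding \<psi>_def d\<psi>_def inner_add_left inner_scaleR_left
        by (auto intro!: derivative_eq_intros)
      show "((\<lambda>t. \<phi> n (x + t *\<^sub>R Q h) * \<psi> (x + t *\<^sub>R Q h)) has_real_derivative q x * \<psi> x + \<phi> n x * d\<psi> x) (at 0)"
        using DERIV_mult[OF has_derivative_line[OF g(1), of n x "Q h"] l] by (simp add: q_def algebra_simps)
      show "\<bar>\<phi> n x * \<psi> x\<bar> \<le> C n + C n * norm (Q h) + C n * \<bar>inner (Q h) k\<bar>"
        using mult_mono[OF g(3)[of n x] \<psi>1[of x] C0] C0 by (simp add: abs_mult add_increasing2)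
      have "\<bar>q x * \<psi> x\<bar> \<le> C n * norm (Q h)"
        using mult_mono[OF q1[of x] \<psi>1[of x]] C0 by (simp add: abs_mult)
      moreover have "\<bar>\<phi> n x * d\<psi> x\<bar> \<le> C n * \<bar>inner (Q h) k\<bar>"
        using mult_mono[OF g(3)[of n x] d\<psi>1[of x] C0] by (simp add: abs_mult)
      ultimately show "\<bar>q x * \<psi> x + \<phi> n x * d\<psi> x\<bar> \<le> C n + C n * norm (Q h) + C n * \<bar>inner (Q h) k\<bar>"
        using C0 by linarith
    next
      show "continuous_on UNIV (\<lambda>x. \<phi> n x * \<psi> x)" "continuous_on UNIV (\<lambda>x. q x * \<psi> x + \<phi> n x * d\<psi> x)"
        unfolding \<psi>_def d\<psi>_def q_def by (intro continuous_intros cont g)+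
    qed
    moreover have i1: "integrable \<gamma> (\<lambda>x. q x * \<psi> x)"
      by (rule integrable_const_bound[where B = "C n * norm (Q h)"])
         (use mult_mono[OF q1 \<psi>1] C0 in \<open>auto simp: abs_mult\<close>)
    moreover have i2: "integrable \<gamma> (\<lambda>x. \<phi> n x * d\<psi> x)"
      by (rule integrable_const_bound[where B = "C n * \<bar>inner (Q h) k\<bar>"])
         (use mult_mono[OF g(3) d\<psi>1] C0 in \<open>auto simp: abs_mult\<close>)
    moreover have i3: "integrable \<gamma> (\<lambda>x. (\<phi> n x * \<psi> x) * inner x h)"
    proof (rule Bochner_Integration.integrable_bound)
      show "integrable \<gamma> (\<lambda>x. C n * inner x h)" by (intro integrable_mult_right integrable_inner)
      have "\<bar>\<phi> n x * \<psi> x\<bar> \<le> \<bar>C n\<bar>" for x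
        using mult_mono[OF g(3)[of n x] \<psi>1[of x] C0] C0 by (simp add: abs_mult)
      then show "AE x in \<gamma>. norm (\<phi> n x * \<psi> x * inner x h) \<le> norm (C n * inner x h)"
        unfolding real_norm_def abs_mult[of _ "inner _ _"] by (intro AE_I2 mult_right_mono) auto
    qed measurable
    ultimately have "(\<integral>x. q x * \<psi> x \<partial>\<gamma>) = (\<integral>x. (\<phi> n x * \<psi> x) * inner x h - \<phi> n x * d\<psi> x \<partial>\<gamma>)"
      by simp
    then show ?thesis unfolding q by (simp add: w_def algebra_simps)
  qed
  have bsq: "integrable \<gamma> (\<lambda>x. (a x)\<^sup>2)" if [measurable]: "a \<in> borel_measurable borel" and "\<And>x. \<bar>a x\<bar> \<le> B" for a :: "'a \<Rightarrow> real" and B :: real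
  proof (rule integrable_const_bound[where B = "B\<^sup>2"])
    show "AE x in \<gamma>. norm ((a x)\<^sup>2) \<le> B\<^sup>2"
      using that(2) by (intro AE_I2) (simp add: abs_le_square_iff[symmetric], meson abs_ge_self order_trans)
  qed measurable
  have wsq: "integrable \<gamma> (\<lambda>x. (w x)\<^sup>2)"
  proof (rule Bochner_Integration.integrable_bound)
    show "integrable \<gamma> (\<lambda>x. 2 * (inner x h)\<^sup>2 + 2 * (inner (Q h) k)\<^sup>2)"
      by (intro Bochner_Integration.integrable_add integrable_mult_right integrable_inner_sq integrable_const)
    have "(w x)\<^sup>2 \<le> 2 * (inner x h)\<^sup>2 + 2 * (inner (Q h) k)\<^sup>2" for x
    proof -
      have "(w x)\<^sup>2 \<le> 2 * (\<psi> x * inner x h)\<^sup>2 + 2 * (d\<psi> x)\<^sup>2"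
        using zero_le_power2[of "\<psi> x * inner x h + d\<psi> x"]
        unfolding w_def power2_diff power2_sum by linarith
      moreover have "(\<psi> x * inner x h)\<^sup>2 \<le> (inner x h)\<^sup>2"
        using \<psi>1[of x] by (simp add: power_mult_distrib abs_square_le_1 mult_left_le_one_le)
      moreover have "(d\<psi> x)\<^sup>2 \<le> (inner (Q h) k)\<^sup>2"
        using d\<psi>1[of x] by (simp add: abs_le_square_iff[symmetric])
      ultimately show ?thesis by linarith
    qed
    then show "AE x in \<gamma>. norm ((w x)\<^sup>2) \<le> norm (2 * (inner x h)\<^sup>2 + 2 * (inner (Q h) k)\<^sup>2)" by simp
  qed measurable
  have lim1: "(\<lambda>n. \<integral>x. \<phi> n x * w x \<partial>\<gamma>) \<longlonglongrightarrow> (\<integral>x. f x * w x \<partial>\<gamma>)"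
  proof (rule L2_tendsto_integral)
    show "integrable \<gamma> (\<lambda>x. (f x)\<^sup>2)" using f by (simp add: L2_fun_def)
    show "integrable \<gamma> (\<lambda>x. (\<phi> n x)\<^sup>2)" for n by (rule bsq[OF _ g(3)]) simp
  qed (use lim wsq in simp_all)
  have lim2: "(\<lambda>n. \<integral>x. inner (R (g n x)) (R h) * \<psi> x \<partial>\<gamma>) \<longlonglongrightarrow> (\<integral>x. inner (G x) (R h) * \<psi> x \<partial>\<gamma>)"
  proof (rule L2_tendsto_integral)
    have cs: "(inner v (R h))\<^sup>2 \<le> (norm (R h))\<^sup>2 * (norm v)\<^sup>2" for v
      using Cauchy_Schwarz_ineq[of v "R h"] by (simp add: power2_norm_eq_inner mult.commute)
    show "integrable \<gamma> (\<lambda>x. (inner (G x) (R h))\<^sup>2)"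
    proof (rule Bochner_Integration.integrable_bound)
      show "integrable \<gamma> (\<lambda>x. (norm (R h))\<^sup>2 * (norm (G x))\<^sup>2)" using G by (simp add: L2_fun_def)
    qed (use cs in auto)
    show "integrable \<gamma> (\<lambda>x. (inner (R (g n x)) (R h))\<^sup>2)" for n
    proof (rule bsq[of _ "C n * K * norm (R h)"])
      have "norm (R (g n x)) \<le> C n * K" for x
        using K(2)[of "g n x"] mult_right_mono[OF g(4)[of n x], of K] K(1) by linarith
      then show "\<bar>inner (R (g n x)) (R h)\<bar> \<le> C n * K * norm (R h)" for x
        by (meson Cauchy_Schwarz_ineq2 mult_right_mono norm_ge_zero order_trans)
    qed measurable
    show "integrable \<gamma> (\<lambda>x. (\<psi> x)\<^sup>2)" by (rule bsq[OF _ \<psi>1]) simp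
    have le: "(\<integral>\<^sup>+x. ennreal ((inner (R (g n x)) (R h) - inner (G x) (R h))\<^sup>2) \<partial>\<gamma>)
       \<le> ennreal ((norm (R h))\<^sup>2) * (\<integral>\<^sup>+x. ennreal ((norm (cdp_gradient Q (\<phi> n) x - G x))\<^sup>2) \<partial>\<gamma>)" for n
    proof -
      have "(\<integral>\<^sup>+x. ennreal ((inner (R (g n x)) (R h) - inner (G x) (R h))\<^sup>2) \<partial>\<gamma>)
        \<le> (\<integral>\<^sup>+x. ennreal ((norm (R h))\<^sup>2) * ennreal ((norm (R (g n x) - G x))\<^sup>2) \<partial>\<gamma>)"
        by (intro nn_integral_mono) (simp add: cs ennreal_leI flip: ennreal_mult inner_diff_left)
      then show ?thesis by (simp add: grad nn_integral_cmult)
    qed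
    have "(\<lambda>n. ennreal ((norm (R h))\<^sup>2) * (\<integral>\<^sup>+x. ennreal ((norm (cdp_gradient Q (\<phi> n) x - G x))\<^sup>2) \<partial>\<gamma>))
        \<longlonglongrightarrow> ennreal ((norm (R h))\<^sup>2) * 0"
      by (rule ennreal_tendsto_cmult[OF _ lim(2)]) simp
    then have bound: "(\<lambda>n. ennreal ((norm (R h))\<^sup>2) * (\<integral>\<^sup>+x. ennreal ((norm (cdp_gradient Q (\<phi> n) x - G x))\<^sup>2) \<partial>\<gamma>))
        \<longlonglongrightarrow> 0" by simp
    show "(\<lambda>n. \<integral>\<^sup>+x. ennreal ((inner (R (g n x)) (R h) - inner (G x) (R h))\<^sup>2) \<partial>\<gamma>) \<longlonglongrightarrow> 0"
      by (rule tendsto_sandwich[OF _ _ tendsto_const bound]) (simp, intro always_eventually allI le)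
  qed measurable
  have "(\<integral>x. inner (G x) (R h) * \<psi> x \<partial>\<gamma>) = (\<integral>x. f x * w x \<partial>\<gamma>)"
    using LIMSEQ_unique[OF lim2] lim1 unfolding identity by simp
  then show ?thesis by (simp add: \<psi>_def w_def d\<psi>_def)
qed

text \<open>Closability. The preceding formula determines \<open>\<langle>G(x), R h\<rangle>\<close> almost everywhere
  for each \<open>h\<close>, first for \<open>\<langle>Q h, h\<rangle> = 1\<close> and then by scaling for all \<open>h\<close>; a countable dense set of \<open>h\<close> and the
  injectivity of \<open>R\<close> conclude.\<close>

theorem cdp_graph_unique:
  assumes "(f, G) \<in> cdp_graph \<gamma> Q" and "(f, G') \<in> cdp_graph \<gamma> Q"
  shows "AE x in \<gamma>. G x = G' x"
proof -
  have G: "G \<in> L2_fun \<gamma>" and G': "G' \<in> L2_fun \<gamma>" using assms by (auto simp: cdp_graph_def)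
  then have [measurable]: "G \<in> borel_measurable \<gamma>" "G' \<in> borel_measurable \<gamma>" by (simp_all add: L2_fun_def)
  have int: "integrable \<gamma> (\<lambda>x. inner (F x) v * cos (inner x k + c))" if "F \<in> L2_fun \<gamma>" for F :: "'a \<Rightarrow> 'a" and v k c
  proof (rule Bochner_Integration.integrable_bound)
    have [measurable]: "F \<in> borel_measurable \<gamma>" using that by (simp add: L2_fun_def)
    show "(\<lambda>x. inner (F x) v * cos (inner x k + c)) \<in> borel_measurable \<gamma>" by measurable
    show "integrable \<gamma> (\<lambda>x. norm v * (1 + (norm (F x))\<^sup>2))" using that by (simp add: L2_fun_def)
    have "\<bar>inner (F x) v * cos (inner x k + c)\<bar> \<le> norm v * (1 + (norm (F x))\<^sup>2)" for x
    proof -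
      have "\<bar>inner (F x) v * cos (inner x k + c)\<bar> \<le> \<bar>inner (F x) v\<bar>" by (simp add: abs_mult mult_left_le)
      also have "\<dots> \<le> norm v * norm (F x)" using Cauchy_Schwarz_ineq2[of "F x" v] by (simp add: mult.commute)
      also have "\<dots> \<le> norm v * (1 + (norm (F x))\<^sup>2)"
      proof (rule mult_left_mono)
        have "2 * norm (F x) \<le> 1 + (norm (F x))\<^sup>2" 
          using zero_le_power2[of "norm (F x) - 1"] by (simp add: power2_diff)
        then show "norm (F x) \<le> 1 + (norm (F x))\<^sup>2" using norm_ge_zero[of "F x"] by linarith
      qed simp
      finally show ?thesis .
    qed
    then show "AE x in \<gamma>. norm (inner (F x) v * cos (inner x k + c)) \<le> norm (norm v * (1 + (norm (F x))\<^sup>2))"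
      by (intro AE_I2) (metis abs_ge_self order_trans real_norm_def)
  qed
  have one: "AE x in \<gamma>. inner (G x - G' x) (R h) = 0" if h: "inner (Q h) h = 1" for h
  proof (rule AE_eq_0_if_cos[OF sets_eq finite_measure_axioms])
    show "integrable \<gamma> (\<lambda>x. inner (G x - G' x) (R h))"
      using Bochner_Integration.integrable_diff[OF int[OF G, of "R h" 0 0] int[OF G', of "R h" 0 0]]
      by (simp add: inner_diff_left)
    show "(\<integral>x. inner (G x - G' x) (R h) * cos (inner x k + c) \<partial>\<gamma>) = 0" for k c
    proof -
      have "(\<integral>x. inner (G x - G' x) (R h) * cos (inner x k + c) \<partial>\<gamma>)
        = (\<integral>x. inner (G x) (R h) * cos (inner x k + c) \<partial>\<gamma>) - (\<integral>x. inner (G' x) (R h) * cos (inner x k + c) \<partial>\<gamma>)"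
        unfolding inner_diff_left left_diff_distrib
        by (rule Bochner_Integration.integral_diff) (intro int G G')+
      then show ?thesis using cdp_graph_ibp[OF assms(1) h] cdp_graph_ibp[OF assms(2) h] by simp
    qed
  qed
  have all: "AE x in \<gamma>. inner (R (G x - G' x)) h = 0" for h
  proof (cases "h = 0")
    case False
    define s where "s = norm (R h)"
    have s: "s > 0" using False by (simp add: s_def R_eq_0)
    have "inner (Q h) h = s\<^sup>2" by (simp add: s_def power2_norm_eq_inner R_self R_R)
      (metis R_self R_R)
    then have "inner (Q ((1/s) *\<^sub>R h)) ((1/s) *\<^sub>R h) = 1"
      using s linear_scale[OF bounded_linear.linear[OF bounded_linear_Q], of "1/s" h]
      by (simp add: power2_eq_square)
    from one[OF this] show ?thesis
      by (rule AE_mp) (use s in \<open>simp add: R_self R.scaleR\<close>)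
  qed simp
  obtain D :: "'a set" where D: "countable D" "\<And>X. open X \<Longrightarrow> X \<noteq> {} \<Longrightarrow> \<exists>d\<in>D. d \<in> X"
    using countable_dense_exists by blast
  have "AE x in \<gamma>. \<forall>h\<in>D. inner (R (G x - G' x)) h = 0"
    using all D(1) by (simp add: AE_ball_countable)
  then show ?thesis
  proof (rule AE_mp, intro AE_I2 impI)
    fix x assume *: "\<forall>h\<in>D. inner (R (G x - G' x)) h = 0"
    define u where "u = R (G x - G' x)"
    have "u = 0"
    proof (rule ccontr)
      assume "u \<noteq> 0"
      have "open {h. 0 < inner u h}" by (intro open_Collect_less continuous_intros)
      moreover have "u \<in> {h. 0 < inner u h}" using \<open>u \<noteq> 0\<close> by simp
      ultimately obtain d where "d \<in> D" "0 < inner u d" using D(2)[of "{h. 0 < inner u h}"] by blast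
      then show False using * by (simp add: u_def)
    qed
    then show "G x = G' x" by (simp add: u_def R_eq_0)
  qed
qed

end

section \<open>Trace class and finite dimension\<close>

text \<open>The residue of the orthogonal projection onto a finite orthonormal set is orthogonal to its
  span, hence to the closure of the span.\<close>

lemma orthonormal_basis_finite_span:
  assumes E: "orthonormal_basis E" and fin: "finite E"
  shows "span E = UNIV"
proof -
  have orth: "inner e e' = 0" if "e \<in> E" "e' \<in> E" "e \<noteq> e'" for e e'
    using E that by (auto simp: orthonormal_basis_def pairwise_def orthogonal_def)
  have one: "inner e e = 1" if "e \<in> E" for e
    using E that by (auto simp: orthonormal_basis_def norm_eq_1)
  have dense: "closure (span E) = UNIV" using E by (simp add: orthonormal_basis_def)
  have "x \<in> span E" for x
  proof -
    define p where "p = (\<Sum>e\<in>E. inner x e *\<^sub>R e)"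
    define y where "y = x - p"
    have "inner y e = 0" if "e \<in> E" for e
    proof -
      have "inner p e = (\<Sum>e'\<in>E. if e' = e then inner x e else 0)"
        unfolding p_def inner_sum_left using orth one that by (intro sum.cong) auto
      then show ?thesis using fin that by (simp add: y_def inner_diff_left)
    qed
    then have "span E \<subseteq> {z. inner y z = 0}"
      by (intro span_minimal) (auto simp: subspace_def inner_add_right)
    moreover have "closed {z. inner y z = 0}" by (intro closed_Collect_eq continuous_intros)
    ultimately have "closure (span E) \<subseteq> {z. inner y z = 0}" by (rule closure_minimal)
    then have "inner y y = 0" using dense by blast
    then have "x = p" by (simp add: y_def)
    moreover have "p \<in> span E" unfolding p_def by (intro span_sum span_scale span_base)
    ultimately show ?thesis by simp
  qed
  then show ?thesis by blast
qed

text \<open>The trace of the identity counts the elements of an orthonormal basis.\<close>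

lemma trace_class_id_finite_dim:
  assumes "trace_class (id :: 'a::{real_inner, complete_space} \<Rightarrow> 'a)"
  shows "\<exists>B :: 'a set. finite B \<and> span B = UNIV"
proof -
  have "adjoint (id :: 'a \<Rightarrow> 'a) = id" by (rule adjoint_unique) simp
  then have "op_abs (id :: 'a \<Rightarrow> 'a) = op_sqrt id" by (simp add: op_abs_def)
  also have "\<dots> = id"
    by (rule op_sqrt_eqI) (auto simp: self_adjoint_def nonneg_op_def id_def bounded_linear_ident)
  finally have abs: "op_abs (id :: 'a \<Rightarrow> 'a) = id" .
  obtain E :: "'a set" where E: "orthonormal_basis E" "(\<lambda>e. inner (op_abs id e) e) summable_on E"
    using assms by (auto simp: trace_class_def)
  have "inner (op_abs id e) e = 1" if "e \<in> E" for e
    using E(1) that by (auto simp: abs orthonormal_basis_def norm_eq_1)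
  then have "(\<lambda>_. 1 :: real) summable_on E" using E(2) by (simp cong: summable_on_cong)
  have "finite E"
  proof (rule ccontr)
    assume "infinite E"
    have "\<forall>\<^sub>F F in finite_subsets_at_top E. sum (\<lambda>_. 1) F < infsum (\<lambda>_. 1 :: real) E + 1"
      using order_tendstoD(2)[OF infsum_tendsto[OF \<open>(\<lambda>_. 1 :: real) summable_on E\<close>]] by simp
    then obtain X where X: "finite X" "X \<subseteq> E"
      "\<And>Y. finite Y \<Longrightarrow> X \<subseteq> Y \<Longrightarrow> Y \<subseteq> E \<Longrightarrow> real (card Y) < infsum (\<lambda>_. 1) E + 1"
      unfolding eventually_finite_subsets_at_top by auto
    obtain n where n: "infsum (\<lambda>_. 1 :: real) E + 1 < real n" using reals_Archimedean2 by blast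
    obtain Z where Z: "Z \<subseteq> E" "finite Z" "card Z = n"
      using infinite_arbitrarily_large[OF \<open>infinite E\<close>] by blast
    have "real n \<le> real (card (X \<union> Z))" using Z X(1) card_mono[of "X \<union> Z" Z] by simp
    then show False using X(3)[of "X \<union> Z"] X(1,2) Z n by simp
  qed
  then show ?thesis using orthonormal_basis_finite_span[OF E(1)] by blast
qed

section \<open>Domains and derivatives\<close>

context nondegenerate_gaussian
begin

lemma sin_in_Cb1: "(\<lambda>x. sin (inner x k)) \<in> Cb1"
proof -
  let ?D = "\<lambda>x. cos (inner x k) *\<^sub>R blinfun_inner_left k"
  have "((\<lambda>x. sin (inner x k)) has_derivative blinfun_apply (?D x)) (at x)" for x
    by (auto intro!: derivative_eq_intros simp: scaleR_blinfun.rep_eq)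
  moreover have "continuous_on UNIV ?D" by (intro continuous_intros)
  moreover have "bounded (range ?D)"
    by (rule boundedI[where B = "norm (blinfun_inner_left k)"]) (auto intro!: mult_left_le_one_le)
  moreover have "bounded (range (\<lambda>x. sin (inner x k)))"
    by (rule boundedI[where B = 1]) auto
  ultimately show ?thesis
    unfolding Cb1_def mem_Collect_eq by (intro conjI exI[of _ ?D] allI)
qed

lemma sin_in_cdp_graph: "(\<lambda>x. sin (inner x k), \<lambda>x. cos (inner x k) *\<^sub>R R k) \<in> cdp_graph \<gamma> Q"
proof -
  have "((\<lambda>x. sin (inner x k)) has_derivative inner (cos (inner x k) *\<^sub>R k)) (at x)" for x
    by (auto intro!: derivative_eq_intros simp: inner_commute)
  from cdp_gradient_eq[OF this]
  have grad: "cdp_gradient Q (\<lambda>x. sin (inner x k)) x = cos (inner x k) *\<^sub>R R k" for x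
    by (simp add: R.scaleR)
  have "integrable \<gamma> (\<lambda>x. (norm (sin (inner x k)))\<^sup>2)"
    by (rule integrable_const_bound[where B = 1]) (auto simp: abs_square_le_1)
  moreover have "integrable \<gamma> (\<lambda>x. (norm (cos (inner x k) *\<^sub>R R k))\<^sup>2)"
  proof (rule integrable_const_bound[where B = "(norm (R k))\<^sup>2"])
    show "AE x in \<gamma>. norm ((norm (cos (inner x k) *\<^sub>R R k))\<^sup>2) \<le> (norm (R k))\<^sup>2"
      by (auto simp: power_mult_distrib abs_square_le_1 intro!: mult_left_le_one_le)
  qed measurable
  ultimately show ?thesis
    unfolding cdp_graph_def L2_fun_def mem_Collect_eq prod.case
    using sin_in_Cb1[of k] by (intro conjI exI[of _ "\<lambda>_ x. sin (inner x k)"]) (auto simp: grad)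
qed

text \<open>The mean of \<open>cos\<langle>x, k\<rangle>\<close> is \<open>exp(- \<langle>Q k, k\<rangle> / 2) > 0\<close>.\<close>

lemma not_AE_cos_eq_0: "\<not> (AE x in \<gamma>. cos (inner x k) = 0)"
proof
  assume "AE x in \<gamma>. cos (inner x k) = 0"
  then have "(\<integral>x. cos (inner x k) \<partial>\<gamma>) = (\<integral>x. 0 \<partial>\<gamma>)" by (intro integral_cong_AE) auto
  then show False using integral_cos[of k 0] by simp
qed

lemma W_eq: "W_cdp \<gamma> Q = W_gross \<gamma> Q"
  unfolding W_cdp_def W_gross_def using gross_graph_iff by blast

lemma gross_derivative_eq:
  assumes "f \<in> W_gross \<gamma> Q"
  shows "AE x in \<gamma>. gross_derivative \<gamma> Q f x = R (cdp_derivative \<gamma> Q f x)"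
proof -
  have "(f, gross_derivative \<gamma> Q f) \<in> gross_graph \<gamma> Q"
    unfolding gross_derivative_def by (rule someI_ex[of "\<lambda>G. (f, G) \<in> _"]) (use assms in \<open>auto simp: W_gross_def\<close>)
  then obtain G where G: "gross_derivative \<gamma> Q f = (\<lambda>x. R (G x))" "(f, G) \<in> cdp_graph \<gamma> Q"
    unfolding gross_graph_iff by blast
  have "(f, cdp_derivative \<gamma> Q f) \<in> cdp_graph \<gamma> Q"
    unfolding cdp_derivative_def by (rule someI[of "\<lambda>G. (f, G) \<in> _", OF G(2)])
  from cdp_graph_unique[OF G(2) this] show ?thesis by (rule AE_mp) (simp add: G(1))
qed

lemma derivatives_differ:
  assumes "trace_class Q" and "\<nexists>B :: 'a set. finite B \<and> span B = UNIV"
  shows "\<exists>f \<in> W_gross \<gamma> Q. \<not> (AE x in \<gamma>. gross_derivative \<gamma> Q f x = cdp_derivative \<gamma> Q f x)"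
proof -
  have "\<exists>k. Q k \<noteq> R k"
  proof (rule ccontr)
    assume "\<not> ?thesis"
    then have "R (R k - k) = 0" for k using R_R[of k] by (simp add: R.diff)
    then have "R k = k" for k using R_eq_0 by (metis eq_iff_diff_eq_0)
    then have "Q = id" using R_R by (metis eq_id_iff)
    then show False using trace_class_id_finite_dim assms by blast
  qed
  then obtain k where k: "Q k \<noteq> R k" by blast
  let ?f = "\<lambda>x. sin (inner x k)"
  have "?f \<in> W_cdp \<gamma> Q" unfolding W_cdp_def using sin_in_cdp_graph by blast
  then have f: "?f \<in> W_gross \<gamma> Q" by (simp add: W_eq)
  have "(?f, cdp_derivative \<gamma> Q ?f) \<in> cdp_graph \<gamma> Q"
    unfolding cdp_derivative_def by (rule someI[of "\<lambda>G. (?f, G) \<in> _", OF sin_in_cdp_graph])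
  then have 1: "AE x in \<gamma>. cdp_derivative \<gamma> Q ?f x = cos (inner x k) *\<^sub>R R k"
    using cdp_graph_unique sin_in_cdp_graph by blast
  have "\<not> (AE x in \<gamma>. gross_derivative \<gamma> Q ?f x = cdp_derivative \<gamma> Q ?f x)"
  proof
    assume "AE x in \<gamma>. gross_derivative \<gamma> Q ?f x = cdp_derivative \<gamma> Q ?f x"
    with 1 gross_derivative_eq[OF f] have "AE x in \<gamma>. cos (inner x k) = 0"
    proof eventually_elim
      case (elim x)
      then have "cos (inner x k) *\<^sub>R (Q k - R k) = 0"
        by (auto simp: R.scaleR R_R scaleR_diff_right)
      then show ?case using k by auto
    qed
    then show False using not_AE_cos_eq_0 by blast
  qed
  then show ?thesis using f by blast
qed

end

theorem mainTheorem3: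
  fixes \<gamma> :: "'a::{real_inner, polish_space} measure"
    and Q :: "'a \<Rightarrow> 'a"
  assumes "gaussian_measure \<gamma>" and "centered \<gamma>" and "has_covariance \<gamma> Q"
    and "self_adjoint Q" and "nonneg_op Q" and "trace_class Q"
    and "{x. Q x = 0} = {0}"
  shows "W_cdp \<gamma> Q = W_gross \<gamma> Q
    \<and> (\<forall>f \<in> W_gross \<gamma> Q.
         AE x in \<gamma>. gross_derivative \<gamma> Q f x = op_sqrt Q (cdp_derivative \<gamma> Q f x))
    \<and> ((\<nexists>B :: 'a set. finite B \<and> span B = UNIV) \<longrightarrow>
         (\<exists>f \<in> W_gross \<gamma> Q.
            \<not> (AE x in \<gamma>. gross_derivative \<gamma> Q f x = cdp_derivative \<gamma> Q f x)))"
proof -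
  have "bounded_linear Q" using assms(6) by (simp add: trace_class_def)
  then interpret nondegenerate_gaussian \<gamma> Q
    by (intro nondegenerate_gaussian.intro centered_gaussian.intro nondegenerate_gaussian_axioms.intro assms)
  show ?thesis
    by (intro conjI ballI impI W_eq gross_derivative_eq derivatives_differ[OF assms(6)])
qed

end
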